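(* Let $a>b>0$, $c^2=a^2-b^2$, let $\mathcal{E}$ be the ellipse $x^2/a^2+y^2/b^2=1$, and let $C=[x_c,y_c]$ be a point interior to $\mathcal{E}$. Let $\mathcal{T}_\circ$ be the Poncelet family of triangles inscribed in $\mathcal{E}$ and circumscribing a circle centered at $C$. Then the locus $\mathcal{L}_7$ of the Gergonne point $X_7$ over $\mathcal{T}_\circ$ is an ellipse whose major (resp. minor) axis is parallel to the minor (resp. major) axis of $\mathcal{E}$. With $\delta=\sqrt{(b^4+c^2y_c^2)(a^4-c^2x_c^2)}$, the coordinates of its center $C_7=[x_7,y_7]$ are given by \[ x_7=\frac{4ax_c\left(4a^5+a^3b^2+ab^4-a(4a^2-3b^2)x_c^2-ab^2y_c^2-3b\delta\right)}{a^2(4a^2-b^2)^2-(4a^2-3b^2)^2x_c^2-a^2b^2y_c^2}, \] \[ y_7=\frac{4by_c\left(4b^5+a^2b^3+a^4b-b(4b^2-3a^2)y_c^2-a^2bx_c^2-3a\delta\right)}{b^2(4b^2-a^2)^2-(3a^2-4b^2)^2y_c^2-a^2b^2x_c^2}. \] Furthermore, the ratio $a_7/b_7$ of the semi-axis lengths $a_7$ (major) and $b_7$ (minor) of $\mathcal{L}_7$ is given by \[ \left(\frac{a_7}{b_7}\right)^2=\frac{y_7\,x_c}{x_7\,y_c}. \]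
   Context: For each point $C=[x_c,y_c]$ interior to $\mathcal{E}$ there is a circle $\mathcal{K}$ centered at $C$, nested in $\mathcal{E}$, admitting triangles inscribed in $\mathcal{E}$ with all sides tangent to $\mathcal{K}$; its radius is $r=\big(b\sqrt{a^4-c^2x_c^2}-a\sqrt{b^4+c^2y_c^2}\big)/c^2$. By Poncelet's porism every point of $\mathcal{E}$ is then a vertex of such a triangle. $\mathcal{T}_\circ$ is the one-parameter family of all these triangles; $\mathcal{K}$ is their common incircle. The locus $\mathcal{L}_7$ is the curve swept by $X_7$ as the triangle ranges over $\mathcal{T}_\circ$. The Gergonne point $X_7$ is the point of concurrence of the lines from each vertex to the point where the opposite side touches the incircle; with sidelengths $l_1,l_2,l_3$ its barycentrics are $(l_2+l_3-l_1)^{-1}:(l_3+l_1-l_2)^{-1}:(l_1+l_2-l_3)^{-1}$.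
   Formalization: If y_c=0 and 4a²x_c²=(a²−b²)(4a²−b²), the locus is not an ellipse but the single point C_7, and this is what is proved; the y_7 formula is claimed only where its denominator is nonzero, the axis ratio only for x_c, y_c both nonzero (otherwise these are 0/0). *)

theory Defs
  imports "HOL-Analysis.Analysis"
begin

type_synonym point = "real \<times> real"

text \<open>Here \<open>p\<close> is the horizontal and \<open>q\<close> the vertical semi-axis; either may be the larger one.\<close>

definition axis_ellipse :: "point \<Rightarrow> real \<Rightarrow> real \<Rightarrow> point set" where
  "axis_ellipse M p q = {(x, y). (x - fst M)\<^sup>2 / p\<^sup>2 + (y - snd M)\<^sup>2 / q\<^sup>2 = 1}"

definition axis_ellipse_interior :: "point \<Rightarrow> real \<Rightarrow> real \<Rightarrow> point set" where
  "axis_ellipse_interior M p q = {(x, y). (x - fst M)\<^sup>2 / p\<^sup>2 + (y - snd M)\<^sup>2 / q\<^sup>2 < 1}"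

text \<open>The line through \<open>A\<close> and \<open>B\<close> is tangent to the circle at a point \<open>T\<close> of the side \<open>AB\<close> itself.
  Asking for \<open>T\<close> on the segment is what separates the incircle from the excircles.\<close>

definition side_touches_circle_at :: "point \<Rightarrow> point \<Rightarrow> point \<Rightarrow> real \<Rightarrow> point \<Rightarrow> bool" where
  "side_touches_circle_at A B C r T \<longleftrightarrow>
     T \<in> closed_segment A B \<and> affine hull {A, B} \<inter> sphere C r = {T}"

definition incircle_contacts ::
    "point \<Rightarrow> point \<Rightarrow> point \<Rightarrow> point \<Rightarrow> real \<Rightarrow> point \<Rightarrow> point \<Rightarrow> point \<Rightarrow> bool" where
  "incircle_contacts P1 P2 P3 C r T1 T2 T3 \<longleftrightarrow>
     \<not> collinear {P1, P2, P3} \<and> 0 < r \<and>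
     side_touches_circle_at P2 P3 C r T1 \<and>
     side_touches_circle_at P3 P1 C r T2 \<and>
     side_touches_circle_at P1 P2 C r T3"

definition is_gergonne_point :: "point \<Rightarrow> point \<Rightarrow> point \<Rightarrow> point \<Rightarrow> bool" where
  "is_gergonne_point P1 P2 P3 X \<longleftrightarrow>
     (\<exists>C r T1 T2 T3. incircle_contacts P1 P2 P3 C r T1 T2 T3 \<and>
        X \<in> affine hull {P1, T1} \<and> X \<in> affine hull {P2, T2} \<and> X \<in> affine hull {P3, T3})"

text \<open>The radius is left existential: that it is determined by \<open>a\<close>, \<open>b\<close> and \<open>C\<close> is a
  consequence of the definition, not part of it.\<close>

definition poncelet_triangles :: "real \<Rightarrow> real \<Rightarrow> point \<Rightarrow> (point \<times> point \<times> point) set" where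
  "poncelet_triangles a b C =
     {(P1, P2, P3).
        {P1, P2, P3} \<subseteq> axis_ellipse (0, 0) a b \<and>
        (\<exists>r T1 T2 T3. cball C r \<subseteq> axis_ellipse_interior (0, 0) a b \<and>
           incircle_contacts P1 P2 P3 C r T1 T2 T3)}"

definition gergonne_locus :: "real \<Rightarrow> real \<Rightarrow> point \<Rightarrow> point set" where
  "gergonne_locus a b C =
     {X. \<exists>P1 P2 P3. (P1, P2, P3) \<in> poncelet_triangles a b C \<and> is_gergonne_point P1 P2 P3 X}"

text \<open>At the two interior points \<open>(\<plusminus> c sqrt (4a\<^sup>2 - b\<^sup>2) / (2a), 0)\<close> of the major axis the Gergonne
  point is the same for all triangles of the family, so that the ellipse shrinks to its centre.\<close>

definition stationary_gergonne :: "real \<Rightarrow> real \<Rightarrow> point \<Rightarrow> bool" where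
  "stationary_gergonne a b C \<longleftrightarrow>
     snd C = 0 \<and> 4 * a\<^sup>2 * (fst C)\<^sup>2 = (a\<^sup>2 - b\<^sup>2) * (4 * a\<^sup>2 - b\<^sup>2)"

end

theory Submission
  imports Defs "HOL-Computational_Algebra.Fundamental_Theorem_Algebra"
begin

text \<open>Take complex coordinates in which the incircle is the unit circle, with contact points
  \<open>z1, z2, z3\<close>; each vertex is the pole of a chord. That the three vertices lie on the ellipse
  means \<open>z1 + z2 + z3 = u + v * l\<close> with \<open>l = z1 * z2 * z3\<close>, together with Cayley's closing condition,
  where \<open>u\<close> is complex and \<open>v\<close> real because the axes of the ellipse are the coordinate axes.
  Conversely, \<open>cmod u + v < 1\<close>, so every \<open>l\<close> on the unit circle comes from an acute contact
  triangle. The Gergonne point \<open>w\<close> is the symmedian point of the contact triangle and satisfies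
  \<open>l * (cnj u * cnj w - 2 * v) = 2 * u - 3 * w - v * cnj w\<close>. Since \<open>l\<close> ranges over the unit circle, the
  locus is \<open>cmod (u * w - 2 * v) = cmod (3 * w + v * cnj w - 2 * u)\<close>, a conic without mixed term as
  \<open>v\<close> is real.\<close>

section \<open>Triples on the unit circle\<close>

text \<open>Acuteness is the crux. The sum \<open>z1 + z2 + z3\<close> is the orthocentre of the
  contact triangle, and it lies inside the circle exactly if that triangle is acute, i.e. if the
  circle touches the sides themselves and not their extensions. The free parameter \<open>l\<close>
  is Poncelet's porism: conjugating the sum yields the second symmetric function of the contact
  points, and \<open>l\<close> then cancels from the closing condition. The axes of the locus are
  swapped because \<open>v > 0\<close>: the quadratic part of the conic has the coefficient
  \<open>(3 + v)^2 - (cmod u)^2\<close> horizontally and \<open>(3 - v)^2 - (cmod u)^2\<close>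
  vertically, so the horizontal semi-axis is the shorter one. The coordinates of the centre are
  quotients whose positive denominators contain \<delta>. The stated fractions arise by
  rationalising them, and this is what makes the fraction for the second coordinate degenerate for
  some \<open>C\<close>, although the centre itself is always defined.\<close>

lemma cnj_eq_inverse_if_unit: "cmod z = 1 \<Longrightarrow> cnj z = inverse z"
  by (metis complex_norm_square inverse_unique mult.commute of_real_1 power_one)

lemma unit_mult_cnj: "cmod z = 1 \<Longrightarrow> z * cnj z = 1"
  by (metis complex_norm_square of_real_1 power_one)

text \<open>Conjugation is inversion on the unit circle, so the second symmetric function is fixed
  by the first and the third. Up to order, a contact triangle is thus encoded by its sum and
  product.\<close>

lemma unit_sum_cnj:
  assumes "cmod z1 = 1" "cmod z2 = 1" "cmod z3 = 1"
  shows "z1 * z2 * z3 * cnj (z1 + z2 + z3) = z1 * z2 + z2 * z3 + z3 * z1"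
proof -
  have "z1 \<noteq> 0" "z2 \<noteq> 0" "z3 \<noteq> 0" using assms by auto
  then show ?thesis
    using assms by (simp add: cnj_eq_inverse_if_unit field_simps)
qed

text \<open>The tangent at \<open>z\<close> passes through \<open>p\<close> iff
  \<open>p * cnj z + cnj p * z = 2\<close>. For unit \<open>z\<close> this is a quadratic equation
  in \<open>z\<close>; its roots are the two contact points and the conclusions are Vieta's
  formulas.\<close>

lemma pole_of_chord:
  assumes "cmod z1 = 1" "cmod z2 = 1" "z1 \<noteq> z2"
    and "p * cnj z1 + cnj p * z1 = 2" "p * cnj z2 + cnj p * z2 = 2"
  shows "cnj p * (z1 + z2) = 2" "p * (z1 + z2) = 2 * z1 * z2"
proof -
  have nz: "z1 \<noteq> 0" "z2 \<noteq> 0" using assms by auto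
  have 1: "p + cnj p * z1\<^sup>2 = 2 * z1" and 2: "p + cnj p * z2\<^sup>2 = 2 * z2"
    using assms nz by (simp_all add: cnj_eq_inverse_if_unit field_simps power2_eq_square)
  have "(z1 - z2) * (cnj p * (z1 + z2) - 2) = 0"
    using 1 2 by algebra
  then show 3: "cnj p * (z1 + z2) = 2" using assms(3) by auto
  show "p * (z1 + z2) = 2 * z1 * z2" using 1 3 by algebra
qed

text \<open>Subtracting two of the three equations and dividing by the difference of the points leaves
  an expression that is linear in the remaining point and takes the value \<open>0\<close> at all three.\<close>

lemma poncelet_sums:
  fixes u u' v m z1 z2 z3 :: "'a::field"
  assumes distinct: "z1 \<noteq> z2" "z2 \<noteq> z3" "z3 \<noteq> z1"
    and 12: "(z1 + z2)\<^sup>2 - (z1 + z2) * (u + u' * z1 * z2) + v * (z1\<^sup>2 * z2\<^sup>2 + 1) - m * z1 * z2 = 0"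
    and 23: "(z2 + z3)\<^sup>2 - (z2 + z3) * (u + u' * z2 * z3) + v * (z2\<^sup>2 * z3\<^sup>2 + 1) - m * z2 * z3 = 0"
    and 31: "(z3 + z1)\<^sup>2 - (z3 + z1) * (u + u' * z3 * z1) + v * (z3\<^sup>2 * z1\<^sup>2 + 1) - m * z3 * z1 = 0"
  shows "z1 + z2 + z3 = u + v * (z1 * z2 * z3)"
    and "m = 1 - u' * (z1 + z2 + z3) + v * (z1 * z2 + z2 * z3 + z3 * z1)"
proof -
  define k where "k = 1 - u' * (z1 + z2 + z3) + v * (z1 * z2 + z2 * z3 + z3 * z1) - m"
  define h where "h = z1 + z2 + z3 - u - v * (z1 * z2 * z3)"
  have "(z2 - z3) * (z1 * k + h) = 0" unfolding k_def h_def using 12 31 by algebra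
  then have 1: "z1 * k + h = 0" using distinct by simp
  have "(z1 - z3) * (z2 * k + h) = 0" unfolding k_def h_def using 12 23 by algebra
  then have 2: "z2 * k + h = 0" using distinct by simp
  have "(z1 - z2) * k = 0" using 1 2 by algebra
  then have "k = 0" using distinct by simp
  then have "h = 0" using 1 by simp
  show "z1 + z2 + z3 = u + v * (z1 * z2 * z3)" using \<open>h = 0\<close> unfolding h_def by algebra
  show "m = 1 - u' * (z1 + z2 + z3) + v * (z1 * z2 + z2 * z3 + z3 * z1)"
    using \<open>k = 0\<close> unfolding k_def by algebra
qed

text \<open>Converse of \<open>poncelet_sums\<close>, with \<open>cnj u\<close> in the role of
  \<open>u'\<close>. After multiplication by \<open>z3\<close> the other two points can be
  eliminated in favour of \<open>z3\<close> and the symmetric functions.\<close>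

lemma poncelet_vertex:
  fixes u u' v z1 z2 z3 :: "'a::field"
  assumes "z3 \<noteq> 0"
    and e1: "z1 + z2 + z3 = u + v * (z1 * z2 * z3)"
    and e2: "z1 * z2 + z2 * z3 + z3 * z1 = u' * (z1 * z2 * z3) + v"
    and m: "m = 1 - u' * u + v\<^sup>2"
  shows "(z1 + z2)\<^sup>2 - (z1 + z2) * (u + u' * z1 * z2) + v * (z1\<^sup>2 * z2\<^sup>2 + 1) - m * z1 * z2 = 0"
proof -
  have "z3 * ((z1 + z2)\<^sup>2 - (z1 + z2) * (u + u' * z1 * z2) + v * (z1\<^sup>2 * z2\<^sup>2 + 1) - m * z1 * z2) = 0"
    using e1 e2 m by algebra
  then show ?thesis using assms(1) by simp
qed

section \<open>Cevians through the contact points\<close>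

lemma mem_affine_hull_2_cross:
  fixes p q w :: complex
  assumes "p \<noteq> q"
  shows "w \<in> affine hull {p, q} \<longleftrightarrow> (w - p) * cnj (q - p) = cnj (w - p) * (q - p)"
proof
  assume "w \<in> affine hull {p, q}"
  then obtain k where "w = p + k *\<^sub>R (q - p)" unfolding affine_hull_2_alt by blast
  then show "(w - p) * cnj (q - p) = cnj (w - p) * (q - p)"
    by (simp add: scaleR_conv_of_real)
next
  assume eq: "(w - p) * cnj (q - p) = cnj (w - p) * (q - p)"
  have nz: "q - p \<noteq> 0" "cnj q - cnj p \<noteq> 0" using assms by auto
  then have "(w - p) / (q - p) = cnj ((w - p) / (q - p))"
    using eq by (simp add: field_simps)
  then have "(w - p) / (q - p) \<in> \<real>" by (metis Reals_cnj_iff)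
  then obtain k :: real where "(w - p) / (q - p) = of_real k" by (auto elim: Reals_cases)
  then have "w = p + k *\<^sub>R (q - p)" using nz by (simp add: field_simps scaleR_conv_of_real)
  then show "w \<in> affine hull {p, q}" unfolding affine_hull_2_alt by blast
qed

text \<open>This is the cross-product equation of the line, cleared of its denominators and arranged
  so that, besides symmetric functions of the contact points, only \<open>z1\<close> occurs. That
  makes the three cevians comparable.\<close>

lemma cevian_iff:
  assumes unit: "cmod z1 = 1" "cmod z2 = 1" "cmod z3 = 1"
    and nz: "z2 + z3 \<noteq> 0" and p: "p = 2 * z2 * z3 / (z2 + z3)" and "p \<noteq> z1"
  shows "w \<in> affine hull {p, z1} \<longleftrightarrow>
    w * ((z1 + z2 + z3) - 3 * z1) - cnj w * (z1 * (z1 * z2 + z2 * z3 + z3 * z1) - 3 * (z1 * z2 * z3))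
      = 2 * (z1 * z2 + z2 * z3 + z3 * z1) - 2 * z1 * (z1 + z2 + z3)"
proof -
  have z: "z1 \<noteq> 0" "z2 \<noteq> 0" "z3 \<noteq> 0" using unit by auto
  have pc: "cnj p = 2 / (z2 + z3)"
    using unit z nz unfolding p by (simp add: cnj_eq_inverse_if_unit field_simps)
  have c1: "cnj z1 = 1 / z1" using unit by (simp add: cnj_eq_inverse_if_unit inverse_eq_divide)
  \<comment> \<open>Named reciprocals become variables subject to a polynomial relation, so that
    \<open>algebra\<close> can clear the denominators.\<close>
  define y where "y = 1 / (z2 + z3)"
  have y: "y * (z2 + z3) = 1" using nz by (simp add: y_def)
  define x where "x = 1 / z1"
  have x: "x * z1 = 1" using z by (simp add: x_def)
  have "(w - p) * cnj (z1 - p) - cnj (w - p) * (z1 - p)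
      = (w - 2 * z2 * z3 * y) * (x - 2 * y) - (cnj w - 2 * y) * (z1 - 2 * z2 * z3 * y)"
    using pc c1 by (simp add: p x_def y_def)
  also have "\<dots> * (z1 * (z2 + z3)) =
      w * ((z1 + z2 + z3) - 3 * z1) - cnj w * (z1 * (z1 * z2 + z2 * z3 + z3 * z1) - 3 * (z1 * z2 * z3))
      - (2 * (z1 * z2 + z2 * z3 + z3 * z1) - 2 * z1 * (z1 + z2 + z3))"
    using x y by algebra
  finally have *: "((w - p) * cnj (z1 - p) - cnj (w - p) * (z1 - p)) * (z1 * (z2 + z3)) =
      w * ((z1 + z2 + z3) - 3 * z1) - cnj w * (z1 * (z1 * z2 + z2 * z3 + z3 * z1) - 3 * (z1 * z2 * z3))
      - (2 * (z1 * z2 + z2 * z3 + z3 * z1) - 2 * z1 * (z1 + z2 + z3))" .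
  have "w \<in> affine hull {p, z1} \<longleftrightarrow> (w - p) * cnj (z1 - p) - cnj (w - p) * (z1 - p) = 0"
    using mem_affine_hull_2_cross[OF \<open>p \<noteq> z1\<close>] by simp
  also have "\<dots> \<longleftrightarrow> ((w - p) * cnj (z1 - p) - cnj (w - p) * (z1 - p)) * (z1 * (z2 + z3)) = 0"
    using z nz by simp
  finally show ?thesis unfolding * by simp
qed

text \<open>The three cevian equations of \<open>cevian_iff\<close> are values of one linear polynomial, so they hold
  together exactly if both of its coefficients vanish; the two coefficients are conjugate.\<close>

lemma gergonne_iff:
  assumes unit: "cmod z1 = 1" "cmod z2 = 1" "cmod z3 = 1"
    and distinct: "z1 \<noteq> z2" "z2 \<noteq> z3" "z3 \<noteq> z1"
    and nz: "z2 + z3 \<noteq> 0" "z3 + z1 \<noteq> 0" "z1 + z2 \<noteq> 0"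
    and p1: "p1 = 2 * z2 * z3 / (z2 + z3)" and p2: "p2 = 2 * z3 * z1 / (z3 + z1)"
    and p3: "p3 = 2 * z1 * z2 / (z1 + z2)"
    and ne: "p1 \<noteq> z1" "p2 \<noteq> z2" "p3 \<noteq> z3"
  shows "w \<in> affine hull {p1, z1} \<and> w \<in> affine hull {p2, z2} \<and> w \<in> affine hull {p3, z3} \<longleftrightarrow>
    3 * w + (z1 * z2 + z2 * z3 + z3 * z1) * cnj w = 2 * (z1 + z2 + z3)"
proof -
  define e1 e2 e3 where e: "e1 = z1 + z2 + z3" "e2 = z1 * z2 + z2 * z3 + z3 * z1" "e3 = z1 * z2 * z3"
  have perm: "z2 + z3 + z1 = e1" "z2 * z3 + z3 * z1 + z1 * z2 = e2" "z2 * z3 * z1 = e3"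
    "z3 + z1 + z2 = e1" "z3 * z1 + z1 * z2 + z2 * z3 = e2" "z3 * z1 * z2 = e3"
    by (simp_all add: e algebra_simps)
  let ?L = "\<lambda>z. w * (e1 - 3 * z) - cnj w * (z * e2 - 3 * e3) = 2 * e2 - 2 * z * e1"
  have L: "w \<in> affine hull {p1, z1} \<longleftrightarrow> ?L z1" "w \<in> affine hull {p2, z2} \<longleftrightarrow> ?L z2"
    "w \<in> affine hull {p3, z3} \<longleftrightarrow> ?L z3"
    using cevian_iff[OF unit(1,2,3) nz(1) p1 ne(1), of w]
      cevian_iff[OF unit(2,3,1) nz(2) p2 ne(2), of w]
      cevian_iff[OF unit(3,1,2) nz(3) p3 ne(3), of w]
    unfolding perm e[symmetric] by blast+
  have z: "z1 \<noteq> 0" "z2 \<noteq> 0" "z3 \<noteq> 0" using unit by auto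
  have e3: "e3 * cnj e3 = 1" using unit z by (simp add: e cnj_eq_inverse_if_unit field_simps)
  have e12: "e3 * cnj e1 = e2" unfolding e using unit_sum_cnj[OF unit] .
  then have e21: "e3 * cnj e2 = e1"
    using e3 by (metis complex_cnj_cnj complex_cnj_mult mult.commute mult.left_commute mult.right_neutral)
  show ?thesis unfolding L e[symmetric]
  proof
    assume "?L z1 \<and> ?L z2 \<and> ?L z3"
    then have "(z1 - z2) * (3 * w + e2 * cnj w - 2 * e1) = 0" by algebra
    then show "3 * w + e2 * cnj w = 2 * e1" using distinct by simp
  next
    assume 1: "3 * w + e2 * cnj w = 2 * e1"
    then have "cnj (3 * w + e2 * cnj w) = cnj (2 * e1)" by simp
    then have "e3 * (3 * cnj w + cnj e2 * w) = e3 * (2 * cnj e1)" by simp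
    then have "3 * e3 * cnj w + e1 * w = 2 * e2" using e12 e21 by algebra
    then show "?L z1 \<and> ?L z2 \<and> ?L z3" using 1 by algebra
  qed
qed

section \<open>Existence of contact triangles with given sum and product\<close>

lemma cubic_roots:
  fixes a b c :: complex
  obtains z1 z2 z3 where "z1 + z2 + z3 = a" "z1 * z2 + z2 * z3 + z3 * z1 = b" "z1 * z2 * z3 = c"
proof -
  have "\<not> constant (poly [:- c, b, - a, 1:])"
    by (simp add: constant_degree)
  from fundamental_theorem_of_algebra[OF this]
  obtain z1 where "poly [:- c, b, - a, 1:] z1 = 0" by blast
  then have z1: "z1 * z1 * z1 - a * z1 * z1 + b * z1 - c = 0" by (simp add: algebra_simps)
  define s p where sp: "s = a - z1" "p = b - z1 * s"
  define d where "d = csqrt (s\<^sup>2 - 4 * p)"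
  have d: "d\<^sup>2 = s\<^sup>2 - 4 * p" by (simp add: d_def)
  define x y where "x = (s + d) / 2" and "y = (s - d) / 2"
  have xy2: "2 * x = s + d" "2 * y = s - d" unfolding x_def y_def by simp_all
  then have "2 * (x + y) = 2 * s" "4 * (x * y) = 4 * p" using d by algebra+
  then have xy: "x + y = s" "x * y = p" by (metis mult_left_cancel zero_neq_numeral)+
  show ?thesis
  proof (rule that)
    show "z1 + x + y = a" using xy(1) by (simp add: sp(1) add.assoc)
    have "z1 * x + x * y + y * z1 = z1 * (x + y) + x * y" by (simp add: algebra_simps)
    then show "z1 * x + x * y + y * z1 = b" using xy by (simp add: sp(2))
    have "z1 * x * y = z1 * p" by (simp add: xy(2) mult.assoc)
    also have "\<dots> = c" using z1 by (simp add: sp algebra_simps)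
    finally show "z1 * x * y = c" .
  qed
qed

text \<open>Roots of a self-inversive cubic off the unit circle come in pairs \<open>z\<close>, \<open>1 / cnj z\<close>; such a pair
  forces the sum of the roots out of the unit disc.\<close>

lemma sum_with_reflected_pair:
  assumes "cmod z \<noteq> 1" "z * cnj y = 1" "cmod (z * y * x) = 1"
  shows "cmod (z + y + x) > 1"
proof -
  have z: "z \<noteq> 0" "y \<noteq> 0" using assms by auto
  have zy: "cmod z * cmod y = 1" using arg_cong[OF assms(2), of cmod] by (simp add: norm_mult)
  then have x: "cmod x = 1" using assms(3) by (simp add: norm_mult)
  \<comment> \<open>The reflected point \<open>y\<close> has the direction of \<open>z\<close>, so
    the moduli add up in \<open>z + y\<close>. They are distinct with product 1, hence their sum
    exceeds 2.\<close>
  have y: "z = (cmod z)\<^sup>2 *\<^sub>R y"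
  proof -
    have "z * (y * cnj y) = y" using assms(2) by algebra
    then have "z * (cmod y)\<^sup>2 = y" by (simp only: complex_norm_square)
    then have 1: "z * (of_real (cmod y))\<^sup>2 = y" by simp
    have 2: "(of_real (cmod z))\<^sup>2 * (of_real (cmod y))\<^sup>2 = (1::complex)"
      by (metis zy of_real_1 of_real_mult power_mult_distrib power_one)
    have "z = a\<^sup>2 * y" if "z * b\<^sup>2 = y" "a\<^sup>2 * b\<^sup>2 = 1" for a b
    proof -
      have "a\<^sup>2 * y = z * (a\<^sup>2 * b\<^sup>2)" unfolding that(1)[symmetric] by (simp add: ac_simps)
      then show ?thesis using that(2) by simp
    qed
    from this[OF 1 2] show ?thesis by (simp add: scaleR_conv_of_real)
  qed
  have "z + y = ((cmod z)\<^sup>2 + 1) *\<^sub>R y" by (metis y scaleR_add_left scaleR_one)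
  then have "cmod (z + y) = cmod (((cmod z)\<^sup>2 + 1) *\<^sub>R y)" by (rule arg_cong)
  also have "\<dots> = ((cmod z)\<^sup>2 + 1) * cmod y" by (simp only: norm_scaleR) simp
  also have "\<dots> = cmod z + cmod y" using zy by (simp add: algebra_simps power2_eq_square)
  finally have 1: "cmod (z + y) = cmod z + cmod y" .
  have "cmod z \<noteq> cmod y"
  proof
    assume "cmod z = cmod y"
    then have "(cmod z)\<^sup>2 = 1" using zy by (simp add: power2_eq_square)
    then show False using assms(1) norm_ge_zero[of z] by (auto simp: power2_eq_1_iff)
  qed
  then have "0 < (cmod z - cmod y)\<^sup>2" by simp
  then have "4 < (cmod z + cmod y)\<^sup>2" using zy by (simp add: power2_eq_square algebra_simps)
  then have "2 < cmod z + cmod y"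
    using power2_less_imp_less[of 2 "cmod z + cmod y"] by simp
  then have "2 < cmod (z + y)" using 1 by simp
  moreover have "cmod (z + y) \<le> cmod (z + y + x) + cmod x"
    using norm_triangle_ineq4[of "z + y + x" x] by simp
  ultimately show ?thesis using x by simp
qed

text \<open>Since \<open>cmod l = 1\<close>, the second coefficient \<open>l * cnj h\<close> makes
  the roots of the cubic invariant under reflection in the circle, so a root off the circle would
  contradict \<open>sum_with_reflected_pair\<close>. A double root on the circle would give a sum of
  modulus at least 2 - 1.\<close>

lemma unit_triple_exists:
  assumes h: "cmod h < 1" and l: "cmod l = 1"
  obtains z1 z2 z3 where "cmod z1 = 1" "cmod z2 = 1" "cmod z3 = 1"
    "z1 \<noteq> z2" "z2 \<noteq> z3" "z3 \<noteq> z1" "z1 + z2 + z3 = h" "z1 * z2 * z3 = l"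
proof -
  have unit: "cmod z1 = 1"
    if e: "z1 + z2 + z3 = h" "z1 * z2 + z2 * z3 + z3 * z1 = l * cnj h" "z1 * z2 * z3 = l" for z1 z2 z3
  proof (rule ccontr)
    assume n1: "cmod z1 \<noteq> 1"
    have z: "z1 \<noteq> 0" using e(3) l by auto
    have l1: "l * cnj l = 1" using l by (metis complex_norm_square mult.right_neutral of_real_1 power2_eq_square)
    have id: "w ^ 3 - h * w\<^sup>2 + l * cnj h * w - l = (w - z1) * (w - z2) * (w - z3)" for w
    proof -
      have "w ^ 3 - (z1 + z2 + z3) * w\<^sup>2 + (z1 * z2 + z2 * z3 + z3 * z1) * w - z1 * z2 * z3
        = (w - z1) * (w - z2) * (w - z3)"
        by (simp add: algebra_simps power2_eq_square power3_eq_cube)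
      then show ?thesis unfolding e .
    qed
    have "z1 ^ 3 - h * z1\<^sup>2 + l * cnj h * z1 - l = 0" unfolding id by simp
    then have "cnj (z1 ^ 3 - h * z1\<^sup>2 + l * cnj h * z1 - l) = 0" by simp
    then have c: "cnj z1 ^ 3 - cnj h * (cnj z1)\<^sup>2 + cnj l * h * cnj z1 - cnj l = 0" by simp
    define w where "w = 1 / cnj z1"
    have w: "w * cnj z1 = 1" using z by (simp add: w_def)
    have w': "z1 * cnj w = 1" using z by (simp add: w_def)
    have "w ^ 3 - h * w\<^sup>2 + l * cnj h * w - l = 0" using c w l1 by algebra
    then have "(w - z1) * (w - z2) * (w - z3) = 0" unfolding id .
    moreover have "w \<noteq> z1"
    proof
      assume "w = z1"
      then have "z1 * cnj z1 = 1" using w by simp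
      then have "(cmod z1)\<^sup>2 = 1" by (metis complex_norm_square of_real_eq_1_iff)
      then show False using n1 norm_ge_zero[of z1] by (auto simp: power2_eq_1_iff)
    qed
    ultimately have "w = z2 \<or> w = z3" by auto
    then show False
    proof
      assume "w = z2"
      then have "cmod (z1 + z2 + z3) > 1"
        using sum_with_reflected_pair[OF n1, of z2 z3] w' e(3) l by simp
      then show False using h e by simp
    next
      assume "w = z3"
      then have "cmod (z1 + z3 + z2) > 1"
        using sum_with_reflected_pair[OF n1, of z3 z2] w' e(3) l by (simp add: mult_ac)
      then show False using h e by (simp add: add_ac)
    qed
  qed
  have ne: "x \<noteq> y" if "cmod x = 1" "cmod y = 1" "cmod z = 1" "cmod (x + y + z) < 1" for x y z
  proof
    assume "x = y"
    then have "cmod (2 * x) \<le> cmod (x + y + z) + cmod z"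
      using norm_triangle_ineq4[of "x + y + z" z] by simp
    then show False using that by (simp add: norm_mult)
  qed
  obtain z1 z2 z3 where e: "z1 + z2 + z3 = h" "z1 * z2 + z2 * z3 + z3 * z1 = l * cnj h" "z1 * z2 * z3 = l"
    by (rule cubic_roots)
  have u: "cmod z1 = 1" "cmod z2 = 1" "cmod z3 = 1"
    using unit[of z1 z2 z3] unit[of z2 z3 z1] unit[of z3 z1 z2] e by (simp_all add: ac_simps)
  show ?thesis
    using that[OF u _ _ _ e(1,3)] ne[of z1 z2 z3] ne[of z2 z3 z1] ne[of z3 z1 z2] u h e(1)
    by (simp add: ac_simps)
qed

section \<open>Incircles in normalised coordinates\<close>

definition rel_coord :: "point \<Rightarrow> real \<Rightarrow> point \<Rightarrow> complex" where
  "rel_coord C r P = Complex ((fst P - fst C) / r) ((snd P - snd C) / r)"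

lemma inj_rel_coord: "r \<noteq> 0 \<Longrightarrow> inj (rel_coord C r)"
  by (rule injI) (auto simp: rel_coord_def prod_eq_iff)

lemma rel_coord_surj:
  assumes "r \<noteq> 0" obtains P where "rel_coord C r P = w"
proof
  show "rel_coord C r (fst C + r * Re w, snd C + r * Im w) = w"
    using assms by (simp add: rel_coord_def)
qed

lemma rel_coord_affine:
  "rel_coord C r (A + k *\<^sub>R (B - A)) = rel_coord C r A + k *\<^sub>R (rel_coord C r B - rel_coord C r A)"
  by (cases "r = 0") (auto simp: rel_coord_def complex_eq_iff field_simps)

lemma rel_coord_affine_hull:
  assumes "r \<noteq> 0"
  shows "rel_coord C r X \<in> affine hull {rel_coord C r A, rel_coord C r B} \<longleftrightarrow> X \<in> affine hull {A, B}"
  unfolding affine_hull_2_alt rel_coord_affine[symmetric]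
  by (simp add: image_iff inj_eq[OF inj_rel_coord[OF assms]])

lemma rel_coord_closed_segment:
  assumes "r \<noteq> 0"
  shows "rel_coord C r X \<in> closed_segment (rel_coord C r A) (rel_coord C r B) \<longleftrightarrow> X \<in> closed_segment A B"
proof -
  have *: "(1 - k) *\<^sub>R x + k *\<^sub>R y = x + k *\<^sub>R (y - x)" for k and x y :: "'a::real_vector"
    by (simp add: algebra_simps)
  show ?thesis
    unfolding in_segment * rel_coord_affine[symmetric] inj_eq[OF inj_rel_coord[OF assms]] ..
qed

lemma rel_coord_inner:
  assumes "r \<noteq> 0"
  shows "(A - C) \<bullet> (B - C) = r\<^sup>2 * Re (rel_coord C r A * cnj (rel_coord C r B))"
  using assms by (simp add: rel_coord_def inner_prod_def power2_eq_square field_simps)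

lemma Re_mult_cnj_eq_1_iff: "Re (a * cnj z) = 1 \<longleftrightarrow> a * cnj z + cnj a * z = 2"
  by (auto simp: complex_eq_iff algebra_simps)

lemma dist_rel_coord:
  assumes "0 < r"
  shows "dist C P = r \<longleftrightarrow> cmod (rel_coord C r P) = 1"
proof -
  have "dist C P = r \<longleftrightarrow> (dist C P)\<^sup>2 = r\<^sup>2" using assms by simp
  also have "(dist C P)\<^sup>2 = r\<^sup>2 * Re (rel_coord C r P * cnj (rel_coord C r P))"
    using assms by (subst rel_coord_inner[symmetric]) (auto simp: dist_norm power2_norm_eq_inner norm_minus_commute[of C])
  also have "\<dots> = r\<^sup>2 * (cmod (rel_coord C r P))\<^sup>2"
    by (simp only: complex_norm_square[symmetric] Re_complex_of_real)
  finally show ?thesis using assms by (simp add: power2_eq_1_iff) (smt (verit) norm_ge_zero)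
qed

section \<open>Tangent sides in normalised coordinates\<close>

lemma touching_orthogonal:
  assumes "side_touches_circle_at A B C r T"
  shows "(T - C) \<bullet> (B - A) = 0"
proof (rule ccontr)
  assume n: "(T - C) \<bullet> (B - A) \<noteq> 0"
  define d where "d = B - A"
  \<comment> \<open>\<open>T - k *\<^sub>R d\<close> is the mirror image of \<open>T\<close> in the
    perpendicular from \<open>C\<close> to the line, hence a second common point of line and circle
    unless \<open>T\<close> is the foot.\<close>
  define k where "k = 2 * ((T - C) \<bullet> d) / (d \<bullet> d)"
  have d: "d \<bullet> d \<noteq> 0" using n by (auto simp: d_def)
  have T: "T \<in> affine hull {A, B} \<inter> sphere C r"
    and single: "affine hull {A, B} \<inter> sphere C r = {T}"
    using assms unfolding side_touches_circle_at_def by auto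
  obtain l where l: "T = A + l *\<^sub>R d" using T unfolding affine_hull_2_alt d_def by auto
  have "T - k *\<^sub>R d = A + (l - k) *\<^sub>R (B - A)" by (simp add: l d_def algebra_simps)
  then have 1: "T - k *\<^sub>R d \<in> affine hull {A, B}" unfolding affine_hull_2_alt by blast
  have "(norm (T - k *\<^sub>R d - C))\<^sup>2 = (norm ((T - C) - k *\<^sub>R d))\<^sup>2" by (simp add: algebra_simps)
  also have "\<dots> = (norm (T - C))\<^sup>2 - k * (2 * ((T - C) \<bullet> d) - k * (d \<bullet> d))"
    by (simp add: power2_norm_eq_inner inner_diff_left inner_diff_right inner_commute algebra_simps)
  also have "\<dots> = (norm (T - C))\<^sup>2" using d by (simp add: k_def)
  finally have "norm (T - k *\<^sub>R d - C) = norm (T - C)" by simp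
  then have 2: "T - k *\<^sub>R d \<in> sphere C r" using T by (simp add: dist_norm norm_minus_commute)
  have "T - k *\<^sub>R d = T" using single 1 2 by blast
  then show False using n d by (auto simp: k_def d_def)
qed

text \<open>\<open>Re (p * cnj z) = 1\<close> is the equation of the tangent to the unit circle at
  \<open>z\<close>. The singleton intersection thus becomes two equations, linear in the
  vertices.\<close>

lemma side_touches_iff:
  fixes A B C T :: point and r :: real
  assumes r: "0 < r" and ne: "A \<noteq> B"
  defines "a \<equiv> rel_coord C r A" and "b \<equiv> rel_coord C r B" and "z \<equiv> rel_coord C r T"
  shows "side_touches_circle_at A B C r T \<longleftrightarrow>
    z \<in> closed_segment a b \<and> cmod z = 1 \<and> Re (a * cnj z) = 1 \<and> Re (b * cnj z) = 1"
proof -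
  have r0: "r \<noteq> 0" using r by simp
  have in_a: "(A - C) \<bullet> (T - C) = r\<^sup>2 * Re (a * cnj z)" and in_b: "(B - C) \<bullet> (T - C) = r\<^sup>2 * Re (b * cnj z)"
    unfolding a_def b_def z_def by (rule rel_coord_inner[OF r0])+
  show ?thesis
  proof
    assume t: "side_touches_circle_at A B C r T"
    then have o: "(T - C) \<bullet> (B - A) = 0" by (rule touching_orthogonal)
    have seg: "T \<in> closed_segment A B" and "T \<in> sphere C r"
      using t unfolding side_touches_circle_at_def by auto
    then have n: "(T - C) \<bullet> (T - C) = r\<^sup>2"
      by (metis dist_norm mem_sphere norm_minus_commute power2_norm_eq_inner)
    obtain k where k: "T = (1 - k) *\<^sub>R A + k *\<^sub>R B" using seg unfolding in_segment by blast
    then have eqs: "A - C = (T - C) - k *\<^sub>R (B - A)" "B - C = (T - C) + (1 - k) *\<^sub>R (B - A)"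
      by (simp_all add: algebra_simps)
    have "(A - C) \<bullet> (T - C) = (T - C) \<bullet> (T - C) - k * ((T - C) \<bullet> (B - A))"
      unfolding eqs(1) by (simp only: inner_diff_left[of "T - C"] inner_scaleR_left inner_commute[of "B - A"])
    moreover have "(B - C) \<bullet> (T - C) = (T - C) \<bullet> (T - C) + (1 - k) * ((T - C) \<bullet> (B - A))"
      unfolding eqs(2) by (simp only: inner_add_left[of "T - C"] inner_scaleR_left inner_commute[of "B - A"])
    ultimately have "(A - C) \<bullet> (T - C) = r\<^sup>2" "(B - C) \<bullet> (T - C) = r\<^sup>2"
      unfolding n o by simp_all
    then have "Re (a * cnj z) = 1" "Re (b * cnj z) = 1" using in_a in_b r by auto
    then show "z \<in> closed_segment a b \<and> cmod z = 1 \<and> Re (a * cnj z) = 1 \<and> Re (b * cnj z) = 1"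
      using seg \<open>T \<in> sphere C r\<close> dist_rel_coord[OF r, of C T] rel_coord_closed_segment[OF r0, of C T A B]
      unfolding a_def b_def z_def by simp
  next
    assume t: "z \<in> closed_segment a b \<and> cmod z = 1 \<and> Re (a * cnj z) = 1 \<and> Re (b * cnj z) = 1"
    have seg: "T \<in> closed_segment A B"
      using t rel_coord_closed_segment[OF r0, of C T A B] unfolding a_def b_def z_def by simp
    have d: "dist C T = r" using t dist_rel_coord[OF r, of C T] unfolding z_def by simp
    have "(A - C) \<bullet> (T - C) = r\<^sup>2" "(B - C) \<bullet> (T - C) = r\<^sup>2" using t in_a in_b by auto
    then have o: "(B - A) \<bullet> (T - C) = 0" by (simp add: inner_diff_left)
    have "Y = T" if Y: "Y \<in> affine hull {A, B}" "Y \<in> sphere C r" for Y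
    proof -
      obtain k where k: "T = (1 - k) *\<^sub>R A + k *\<^sub>R B" using seg unfolding in_segment by blast
      obtain l where l: "Y = A + l *\<^sub>R (B - A)" using Y(1) unfolding affine_hull_2_alt by blast
      define m where "m = l - k"
      have Ym: "Y - C = (T - C) + m *\<^sub>R (B - A)" by (simp add: k l m_def algebra_simps)
      \<comment> \<open>Pythagoras: by \<open>o\<close>, every other point of the line is farther
        from \<open>C\<close> than \<open>T\<close>.\<close>
      have "(norm (Y - C))\<^sup>2 = (norm (T - C))\<^sup>2 + m\<^sup>2 * (norm (B - A))\<^sup>2"
        unfolding Ym power2_norm_eq_inner using o
        by (simp add: inner_add_left inner_add_right inner_commute power2_eq_square)
      moreover have "norm (Y - C) = norm (T - C)"
        using Y(2) d by (simp add: dist_norm norm_minus_commute)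
      ultimately have "m = 0" using ne by simp
      then show ?thesis using Ym by simp
    qed
    moreover have "T \<in> affine hull {A, B}"
      using subsetD[OF convex_hull_subset_affine_hull seg[unfolded segment_convex_hull]] .
    moreover have "T \<in> sphere C r" using d by simp
    ultimately have "affine hull {A, B} \<inter> sphere C r = {T}" by blast
    then show "side_touches_circle_at A B C r T"
      unfolding side_touches_circle_at_def using seg by blast
  qed
qed

lemma incircle_contacts_ne:
  assumes "incircle_contacts P1 P2 P3 C r T1 T2 T3"
  shows "P1 \<noteq> P2" "P2 \<noteq> P3" "P3 \<noteq> P1"
  using assms unfolding incircle_contacts_def
  by (auto simp: insert_commute)

lemma collinear_if_inner_eq:
  fixes A B D n :: point
  assumes "n \<noteq> 0" "A \<bullet> n = k" "B \<bullet> n = k" "D \<bullet> n = k"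
  shows "collinear {A, B, D}"
proof -
  \<comment> \<open>The normal \<open>n\<close> turned by a right angle, which spans the direction
    of the line.\<close>
  define u where "u = (- snd n, fst n)"
  have nn: "(fst n)\<^sup>2 + (snd n)\<^sup>2 \<noteq> 0" using assms(1) by (simp add: prod_eq_iff sum_power2_eq_zero_iff)
  have "\<exists>c. x - y = c *\<^sub>R u" if "x \<in> {A, B, D}" "y \<in> {A, B, D}" for x y
  proof -
    have "x \<bullet> n = k" "y \<bullet> n = k" using that assms by auto
    then have o: "fst (x - y) * fst n + snd (x - y) * snd n = 0"
      by (simp add: inner_prod_def algebra_simps)
    define c where "c = (snd (x - y) * fst n - fst (x - y) * snd n) / ((fst n)\<^sup>2 + (snd n)\<^sup>2)"
    have c: "c * ((fst n)\<^sup>2 + (snd n)\<^sup>2) = snd (x - y) * fst n - fst (x - y) * snd n"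
      using nn by (simp add: c_def)
    have "(fst (x - y) + c * snd n) * ((fst n)\<^sup>2 + (snd n)\<^sup>2) = 0"
      "(snd (x - y) - c * fst n) * ((fst n)\<^sup>2 + (snd n)\<^sup>2) = 0"
      using o c by algebra+
    then have "fst (x - y) = - c * snd n" "snd (x - y) = c * fst n" using nn by auto
    then have "x - y = c *\<^sub>R u" by (simp add: u_def prod_eq_iff)
    then show ?thesis ..
  qed
  then show ?thesis unfolding collinear_def by blast
qed

text \<open>A tangent meets the circle only at its contact point.\<close>

lemma unit_eq_if_inner_eq_1:
  assumes "cmod z = 1" "cmod w = 1" "Re (z * cnj w) = 1"
  shows "z = w"
proof -
  have "(cmod (z - w))\<^sup>2 = (cmod z)\<^sup>2 + (cmod w)\<^sup>2 - 2 * Re (z * cnj w)"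
    unfolding cmod_power2 by (simp add: power2_eq_square algebra_simps)
  also have "\<dots> = 0" unfolding assms by simp
  finally show ?thesis by simp
qed

text \<open>Two sides with a common contact point would lie on one tangent, and with them all three
  vertices.\<close>

lemma contacts_distinct:
  assumes r: "0 < r" and nc: "\<not> collinear {P1, P2, P3}"
    and t3: "side_touches_circle_at P1 P2 C r T" and t2: "side_touches_circle_at P3 P1 C r T'"
  shows "T \<noteq> T'"
proof
  assume eq: "T = T'"
  have ne: "P1 \<noteq> P2" "P3 \<noteq> P1" using nc by (auto simp: insert_commute)
  let ?f = "rel_coord C r"
  have r0: "r \<noteq> 0" using r by simp
  have "cmod (?f T) = 1" "Re (?f P1 * cnj (?f T)) = 1" "Re (?f P2 * cnj (?f T)) = 1" "Re (?f P3 * cnj (?f T)) = 1"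
    using t3 t2 eq unfolding side_touches_iff[OF r ne(1)] side_touches_iff[OF r ne(2)] by auto
  then have "(P1 - C) \<bullet> (T - C) = r\<^sup>2" "(P2 - C) \<bullet> (T - C) = r\<^sup>2" "(P3 - C) \<bullet> (T - C) = r\<^sup>2"
    "T - C \<noteq> 0"
    unfolding rel_coord_inner[OF r0] by (auto simp: rel_coord_def complex_eq_iff)
  then have "collinear {P1, P2, P3}"
    by (intro collinear_if_inner_eq[of "T - C" _ "r\<^sup>2 + C \<bullet> (T - C)"]) (auto simp: inner_diff_left)
  then show False using nc by simp
qed

text \<open>The vertex at which the tangents with contact points \<open>y\<close> and \<open>z\<close> meet.\<close>

definition pole :: "complex \<Rightarrow> complex \<Rightarrow> complex" where
  "pole y z = 2 * y * z / (y + z)"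

text \<open>Tangents at antipodal points are parallel, so the existence of \<open>p\<close> already
  forces \<open>y + z \<noteq> 0\<close>.\<close>

lemma vertex_eq_pole:
  assumes "cmod y = 1" "cmod z = 1" "y \<noteq> z" "Re (p * cnj y) = 1" "Re (p * cnj z) = 1"
  shows "p = pole y z" "y + z \<noteq> 0" "p \<noteq> y" "p \<noteq> z"
proof -
  have 1: "cnj p * (y + z) = 2" and 2: "p * (y + z) = 2 * y * z"
    using pole_of_chord[OF assms(1-3)] assms(4,5) unfolding Re_mult_cnj_eq_1_iff by auto
  show 3: "y + z \<noteq> 0" using 1 by auto
  show "p = pole y z" unfolding pole_def using 2 3 by (simp add: field_simps)
  show "p \<noteq> y" "p \<noteq> z" using assms unit_eq_if_inner_eq_1 by metis+
qed

text \<open>The last three inequations ensure that each cevian is spanned by two different points: a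
  vertex on the circle would coincide with the contact points of both sides through it.\<close>

lemma incircle_contacts_coords:
  assumes "incircle_contacts P1 P2 P3 C r T1 T2 T3"
  defines "z1 \<equiv> rel_coord C r T1" and "z2 \<equiv> rel_coord C r T2" and "z3 \<equiv> rel_coord C r T3"
  shows "cmod z1 = 1" "cmod z2 = 1" "cmod z3 = 1" "z1 \<noteq> z2" "z2 \<noteq> z3" "z3 \<noteq> z1"
    "z2 + z3 \<noteq> 0" "z3 + z1 \<noteq> 0" "z1 + z2 \<noteq> 0"
    "rel_coord C r P1 = pole z2 z3" "rel_coord C r P2 = pole z3 z1" "rel_coord C r P3 = pole z1 z2"
    "pole z2 z3 \<noteq> z1" "pole z3 z1 \<noteq> z2" "pole z1 z2 \<noteq> z3"
proof -
  have r: "0 < r" and nc: "\<not> collinear {P1, P2, P3}"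
    and t: "side_touches_circle_at P2 P3 C r T1" "side_touches_circle_at P3 P1 C r T2"
      "side_touches_circle_at P1 P2 C r T3"
    using assms(1) unfolding incircle_contacts_def by auto
  note ne = incircle_contacts_ne[OF assms(1)]
  have nc': "\<not> collinear {P2, P3, P1}" "\<not> collinear {P3, P1, P2}" using nc by (simp_all add: insert_commute)
  note dT = contacts_distinct[OF r nc t(3) t(2)] contacts_distinct[OF r nc'(1) t(1) t(3)]
    contacts_distinct[OF r nc'(2) t(2) t(1)]
  have inj: "inj (rel_coord C r)" using inj_rel_coord r by simp
  show d: "z1 \<noteq> z2" "z2 \<noteq> z3" "z3 \<noteq> z1" using dT inj unfolding z1_def z2_def z3_def by (auto dest: injD)
  note t' = t(1)[unfolded side_touches_iff[OF r ne(2)], folded z1_def]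
    t(2)[unfolded side_touches_iff[OF r ne(3)], folded z2_def]
    t(3)[unfolded side_touches_iff[OF r ne(1)], folded z3_def]
  show u: "cmod z1 = 1" "cmod z2 = 1" "cmod z3 = 1" using t' by auto
  note v1 = vertex_eq_pole[OF u(2,3) d(2), of "rel_coord C r P1"]
    and v2 = vertex_eq_pole[OF u(3,1) d(3), of "rel_coord C r P2"]
    and v3 = vertex_eq_pole[OF u(1,2) d(1), of "rel_coord C r P3"]
  show "z2 + z3 \<noteq> 0" "z3 + z1 \<noteq> 0" "z1 + z2 \<noteq> 0" using v1(2) v2(2) v3(2) t' by auto
  show P: "rel_coord C r P1 = pole z2 z3" "rel_coord C r P2 = pole z3 z1" "rel_coord C r P3 = pole z1 z2"
    using v1(1) v2(1) v3(1) t' by auto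
  have "Re (pole z2 z3 * cnj z2) = 1" "Re (pole z3 z1 * cnj z3) = 1" "Re (pole z1 z2 * cnj z1) = 1"
    using t' P by auto
  then show "pole z2 z3 \<noteq> z1" "pole z3 z1 \<noteq> z2" "pole z1 z2 \<noteq> z3"
    using d u unit_eq_if_inner_eq_1 by metis+
qed

section \<open>From acute contact triples back to incircles\<close>

lemma Re_pole_mult_cnj: 
  assumes "cmod y = 1" "cmod z = 1" "y + z \<noteq> 0"
  shows "Re (pole y z * cnj y) = 1" "Re (pole y z * cnj z) = 1"
proof -
  have nz: "y \<noteq> 0" "z \<noteq> 0" using assms by auto
  then have n: "inverse y + inverse z \<noteq> 0" using assms(3) by (auto simp: field_simps add_eq_0_iff)
  have c: "cnj (pole y z) = 2 / (y + z)"
    unfolding pole_def using assms nz by (simp add: cnj_eq_inverse_if_unit field_simps)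
  have "pole y z * cnj y = 2 * z / (y + z)" "pole y z * cnj z = 2 * y / (y + z)"
    using assms nz by (simp_all add: cnj_eq_inverse_if_unit pole_def)
  moreover have "2 * z / (y + z) + 2 * y / (y + z) = 2"
    using assms(3) by (simp add: add_divide_distrib[symmetric] field_simps)
  ultimately show "Re (pole y z * cnj y) = 1" "Re (pole y z * cnj z) = 1"
    unfolding Re_mult_cnj_eq_1_iff c by (simp_all add: add.commute)
qed

text \<open>The product of the pairwise sums is \<open>e1 * e2 - e3\<close> in symmetric functions,
  which by \<open>unit_sum_cnj\<close> equals \<open>e3 * ((cmod e1)^2 - 1)\<close>. Hence the real
  part in question is \<open>2 * (cmod (y + z))^2 / q\<close> with a negative
  \<open>q\<close>.\<close>

lemma acute_imp_Re_pole_less: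
  assumes u: "cmod x = 1" "cmod y = 1" "cmod z = 1" and h: "cmod (x + y + z) < 1"
    and nz: "x + y \<noteq> 0" "y + z \<noteq> 0" "z + x \<noteq> 0"
  shows "Re (pole z x * cnj (pole x y)) < 1"
proof -
  have n: "x \<noteq> 0" "y \<noteq> 0" "z \<noteq> 0" using u by auto
  have c: "cnj (pole x y) = 2 / (x + y)" "cnj (pole z x) = 2 / (z + x)"
    unfolding pole_def using u n nz by (simp_all add: cnj_eq_inverse_if_unit field_simps)
  define q where "q = (cmod (x + y + z))\<^sup>2 - 1"
  have q: "q < 0" using h by (simp add: q_def abs_square_less_1)
  have "(x + y) * (y + z) * (z + x) = (x + y + z) * (x * y + y * z + z * x) - x * y * z"
    by (simp add: algebra_simps)
  also have "\<dots> = x * y * z * ((x + y + z) * cnj (x + y + z) - 1)"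
    unfolding unit_sum_cnj[OF u, symmetric] by (simp add: algebra_simps)
  also have "\<dots> = x * y * z * of_real q" by (simp only: q_def complex_norm_square[symmetric]) simp
  finally have 1: "(x + y) * (y + z) * (z + x) = x * y * z * of_real q" .
  have 2: "(y + z) * (y + z) = of_real ((cmod (y + z))\<^sup>2) * (y * z)"
    unfolding complex_norm_square using u n by (simp add: cnj_eq_inverse_if_unit field_simps)
  let ?p = "pole z x * cnj (pole x y)"
  have "?p = (2 * z * x / (z + x)) * (2 / (x + y))" unfolding c(1) by (simp add: pole_def)
  moreover have "cnj ?p = (2 / (z + x)) * (2 * x * y / (x + y))"
    unfolding complex_cnj_mult complex_cnj_cnj c(2) by (simp add: pole_def)
  ultimately have "?p + cnj ?p = 4 * x * (y + z) / ((x + y) * (z + x))"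
    by (simp only: divide_inverse inverse_mult_distrib) (simp add: algebra_simps)
  also have "\<dots> = 4 * x * (y + z) * (y + z) / ((x + y) * (z + x) * (y + z))"
    by (rule nonzero_mult_divide_mult_cancel_right[OF nz(2), symmetric])
  also have "\<dots> = 4 * x * ((y + z) * (y + z)) / ((x + y) * (y + z) * (z + x))"
    by (simp only: mult.assoc mult.commute[of "y + z" "z + x"])
  also have "\<dots> = of_real (4 * (cmod (y + z))\<^sup>2 / q)"
    unfolding 1 2 using n q by simp
  finally have "2 * Re ?p = 4 * (cmod (y + z))\<^sup>2 / q"
    by (metis Re_complex_of_real complex_add_cnj)
  moreover have "4 * (cmod (y + z))\<^sup>2 / q \<le> 0" using q by (simp add: divide_nonneg_neg)
  ultimately show ?thesis by linarith
qed

text \<open>On the tangent at \<open>z\<close> one has \<open>a = z * (1 + \<i> * \<alpha>)\<close>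
  and \<open>b = z * (1 + \<i> * \<beta>)\<close>, so
  \<open>Re (a * cnj b) = 1 + \<alpha> * \<beta>\<close>. A value below 1 means opposite signs: the
  contact point separates the two vertices.\<close>

lemma contact_in_segment:
  assumes z: "cmod z = 1" and a: "Re (a * cnj z) = 1" and b: "Re (b * cnj z) = 1" and ab: "Re (a * cnj b) < 1"
  shows "z \<in> closed_segment a b" "a \<noteq> b"
proof -
  define \<alpha> \<beta> where "\<alpha> = Im (a * cnj z)" and "\<beta> = Im (b * cnj z)"
  have zz: "z * cnj z = 1" using z by (metis complex_norm_square of_real_1 power_one)
  have ca: "a * cnj z = Complex 1 \<alpha>" and cb: "b * cnj z = Complex 1 \<beta>"
    using a b by (simp_all add: \<alpha>_def \<beta>_def complex_eq_iff)
  have a': "a = z * Complex 1 \<alpha>" and b': "b = z * Complex 1 \<beta>"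
    unfolding ca[symmetric] cb[symmetric] using zz by (metis mult.left_commute mult.right_neutral)+
  have "a * cnj b = Complex 1 \<alpha> * cnj (Complex 1 \<beta>) * (z * cnj z)"
    unfolding a' b' by simp
  then have "Re (a * cnj b) = 1 + \<alpha> * \<beta>" unfolding zz by simp
  then have neg: "\<alpha> * \<beta> < 0" using ab by simp
  then have ne: "\<alpha> - \<beta> \<noteq> 0" by (auto simp: mult_less_0_iff)
  then show "a \<noteq> b" unfolding a' b' using z by auto
  define t where "t = \<alpha> / (\<alpha> - \<beta>)"
  have t: "0 \<le> t" "t \<le> 1" using neg by (auto simp: t_def mult_less_0_iff divide_simps)
  have "\<alpha> - t * (\<alpha> - \<beta>) = 0" using ne by (simp add: t_def)
  then have "(1 - t) *\<^sub>R Complex 1 \<alpha> + t *\<^sub>R Complex 1 \<beta> = 1"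
    by (simp add: complex_eq_iff algebra_simps)
  moreover have "(1 - t) *\<^sub>R a + t *\<^sub>R b = z * ((1 - t) *\<^sub>R Complex 1 \<alpha> + t *\<^sub>R Complex 1 \<beta>)"
    unfolding a' b' by (simp add: algebra_simps)
  ultimately have "(1 - t) *\<^sub>R a + t *\<^sub>R b = z" by simp
  then show "z \<in> closed_segment a b" unfolding in_segment using t by metis
qed

lemma incircle_contacts_if_acute:
  assumes r: "0 < r"
    and z: "z1 = rel_coord C r T1" "z2 = rel_coord C r T2" "z3 = rel_coord C r T3"
    and u: "cmod z1 = 1" "cmod z2 = 1" "cmod z3 = 1"
    and d: "z1 \<noteq> z2" "z2 \<noteq> z3" "z3 \<noteq> z1" and h: "cmod (z1 + z2 + z3) < 1"
    and P: "rel_coord C r P1 = pole z2 z3" "rel_coord C r P2 = pole z3 z1" "rel_coord C r P3 = pole z1 z2"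
  shows "incircle_contacts P1 P2 P3 C r T1 T2 T3"
proof -
  \<comment> \<open>If two of the points cancelled, the sum would be the third one, of modulus
    1.\<close>
  have nz: "z1 + z2 \<noteq> 0" "z2 + z3 \<noteq> 0" "z3 + z1 \<noteq> 0"
    using h u by (auto simp: add.commute add.left_commute) (metis add.commute add.left_commute add_0 less_irrefl)+
  have r0: "r \<noteq> 0" using r by simp
  note R = Re_pole_mult_cnj[OF u(1,2) nz(1)] Re_pole_mult_cnj[OF u(2,3) nz(2)] Re_pole_mult_cnj[OF u(3,1) nz(3)]
  have h': "cmod (z2 + z3 + z1) < 1" "cmod (z3 + z1 + z2) < 1" using h by (simp_all add: add_ac)
  note S = contact_in_segment[OF u(1) R(6,1) acute_imp_Re_pole_less[OF u h nz]]
    contact_in_segment[OF u(2) R(2,3) acute_imp_Re_pole_less[OF u(2,3,1) h'(1) nz(2,3,1)]]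
    contact_in_segment[OF u(3) R(4,5) acute_imp_Re_pole_less[OF u(3,1,2) h'(2) nz(3,1,2)]]
  have ne: "P2 \<noteq> P3" "P3 \<noteq> P1" "P1 \<noteq> P2" using S(2,4,6) P by auto
  have "side_touches_circle_at P2 P3 C r T1" "side_touches_circle_at P3 P1 C r T2"
    "side_touches_circle_at P1 P2 C r T3"
    unfolding side_touches_iff[OF r ne(1)] side_touches_iff[OF r ne(2)] side_touches_iff[OF r ne(3)]
    using S R u unfolding z[symmetric] P by auto
  moreover have "\<not> collinear {P1, P2, P3}"
  proof
    assume "collinear {P1, P2, P3}"
    then have "collinear {P2, P3, P1}" by (simp add: insert_commute)
    then have "P1 \<in> affine hull {P2, P3}" using ne(1) by (simp add: collinear_3_affine_hull)
    then have "pole z2 z3 \<in> affine hull {pole z3 z1, pole z1 z2}"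
      unfolding P[symmetric] rel_coord_affine_hull[OF r0] .
    then obtain k where k: "pole z2 z3 = pole z3 z1 + k *\<^sub>R (pole z1 z2 - pole z3 z1)"
      unfolding affine_hull_2_alt by blast
    \<comment> \<open>The vertex now lies on all three tangents. A point is the pole of any two of
      its contact points, so the three vertices coincide.\<close>
    have "Re (pole z2 z3 * cnj z1) = 1"
      unfolding k using R(1,6) by (simp add: algebra_simps)
    then have "pole z2 z3 = pole z1 z2" "pole z2 z3 = pole z3 z1"
      using vertex_eq_pole(1)[OF u(1,2) d(1), of "pole z2 z3"] vertex_eq_pole(1)[OF u(3,1) d(3), of "pole z2 z3"] R by auto
    then show False using S(2) by simp
  qed
  ultimately show ?thesis unfolding incircle_contacts_def using r by simp
qed

section \<open>Uniqueness of the contact points\<close>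

lemma tangent_length:
  assumes "0 < r" "A \<noteq> B" "side_touches_circle_at A B C r T"
  shows "(dist A T)\<^sup>2 = (dist A C)\<^sup>2 - r\<^sup>2" "(dist B T)\<^sup>2 = (dist B C)\<^sup>2 - r\<^sup>2"
proof -
  have r0: "r \<noteq> 0" using assms by simp
  have t: "dist C T = r" "(A - C) \<bullet> (T - C) = r\<^sup>2" "(B - C) \<bullet> (T - C) = r\<^sup>2"
    using assms(3) unfolding side_touches_iff[OF assms(1,2)] rel_coord_inner[OF r0] dist_rel_coord[OF assms(1)] by auto
  have *: "(dist X T)\<^sup>2 = (dist X C)\<^sup>2 - 2 * ((X - C) \<bullet> (T - C)) + (dist C T)\<^sup>2" for X :: point
    unfolding dist_norm power2_norm_eq_inner
    by (simp add: inner_diff_left inner_diff_right inner_commute algebra_simps)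
  show "(dist A T)\<^sup>2 = (dist A C)\<^sup>2 - r\<^sup>2" "(dist B T)\<^sup>2 = (dist B C)\<^sup>2 - r\<^sup>2"
    unfolding * t by simp_all
qed

lemma closed_segment_dist_unique:
  fixes A B S T :: point
  assumes "S \<in> closed_segment A B" "T \<in> closed_segment A B" "dist A S = dist A T"
  shows "S = T"
proof -
  obtain k where k: "0 \<le> k" "S = (1 - k) *\<^sub>R A + k *\<^sub>R B" using assms(1) unfolding in_segment by blast
  obtain l where l: "0 \<le> l" "T = (1 - l) *\<^sub>R A + l *\<^sub>R B" using assms(2) unfolding in_segment by blast
  have "A - S = k *\<^sub>R (A - B)" "A - T = l *\<^sub>R (A - B)" using k l by (simp_all add: algebra_simps)
  then have "k * norm (A - B) = l * norm (A - B)" using assms(3) k l by (simp add: dist_norm)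
  then have "A = B \<or> k = l" by auto
  then show ?thesis
  proof
    assume "A = B"
    then show ?thesis using assms(1,2) by simp
  next
    assume "k = l"
    then show ?thesis by (simp only: k(2) l(2))
  qed
qed

text \<open>\<open>is_gergonne_point\<close> quantifies over a circle of its own, which must be
  matched with the one of the Poncelet family. Equal tangent lengths express the distances from the
  vertices to the contact points by the side lengths, and a distance from an endpoint determines a
  point of a segment.\<close>

lemma incircle_contacts_unique:
  assumes 1: "incircle_contacts P1 P2 P3 C r T1 T2 T3" and 2: "incircle_contacts P1 P2 P3 C' r' T1' T2' T3'"
  shows "T1' = T1" "T2' = T2" "T3' = T3"
proof -
  note ne = incircle_contacts_ne[OF 1]
  have *: "2 * dist P1 T3 = dist P1 P2 + dist P3 P1 - dist P2 P3 \<and>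
      2 * dist P2 T1 = dist P2 P3 + dist P1 P2 - dist P3 P1 \<and>
      2 * dist P3 T2 = dist P3 P1 + dist P2 P3 - dist P1 P2 \<and>
      T1 \<in> closed_segment P2 P3 \<and> T2 \<in> closed_segment P3 P1 \<and> T3 \<in> closed_segment P1 P2"
    if "incircle_contacts P1 P2 P3 C r T1 T2 T3" for C r T1 T2 T3
  proof -
    have r: "0 < r"
      and t: "side_touches_circle_at P2 P3 C r T1" "side_touches_circle_at P3 P1 C r T2"
        "side_touches_circle_at P1 P2 C r T3"
      using that unfolding incircle_contacts_def by auto
    have seg: "T1 \<in> closed_segment P2 P3" "T2 \<in> closed_segment P3 P1" "T3 \<in> closed_segment P1 P2"
      using t unfolding side_touches_circle_at_def by auto
    have "dist P2 P3 = dist P2 T1 + dist T1 P3" "dist P3 P1 = dist P3 T2 + dist T2 P1"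
      "dist P1 P2 = dist P1 T3 + dist T3 P2"
      using seg unfolding between_mem_segment[symmetric] between by auto
    moreover have "dist P1 T2 = dist P1 T3" "dist P2 T3 = dist P2 T1" "dist P3 T1 = dist P3 T2"
      using tangent_length[OF r ne(1) t(3)] tangent_length[OF r ne(2) t(1)] tangent_length[OF r ne(3) t(2)]
      by (metis zero_le_dist power2_eq_imp_eq)+
    ultimately show ?thesis using seg by (simp add: dist_commute)
  qed
  show "T1' = T1" "T2' = T2" "T3' = T3"
    using *[OF 1] *[OF 2] closed_segment_dist_unique[of _ _ _ T1'] closed_segment_dist_unique[of _ _ _ T2']
      closed_segment_dist_unique[of _ _ _ T3'] by (metis mult_cancel_left zero_neq_numeral)+
qed

section \<open>Poncelet triangles with a given incentre\<close>

text \<open>This eliminates the parameter \<open>l\<close>. If \<open>p\<close> and \<open>q\<close>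
  both vanish, every \<open>l\<close> is a solution: that is how a Gergonne point common to all
  triangles shows up.\<close>

lemma ex_unit_mult_iff: "(\<exists>l. cmod l = 1 \<and> l * p = q) \<longleftrightarrow> cmod p = cmod q"
proof
  assume "cmod p = cmod q"
  then have "p = 0 \<and> q = 0 \<or> p \<noteq> 0 \<and> cmod (q / p) = 1" by (auto simp: norm_divide)
  then show "\<exists>l. cmod l = 1 \<and> l * p = q"
    by (metis mult_zero_right nonzero_eq_divide_eq norm_one)
qed (auto simp: norm_mult)

section \<open>The ellipse in the coordinates of the circle\<close>

locale interior_center =
  fixes a b xc yc :: real
  assumes b_pos: "0 < b" and b_less_a: "b < a"
    and interior: "(xc, yc) \<in> axis_ellipse_interior (0, 0) a b"
begin

definition e where "e = a\<^sup>2 * b\<^sup>2 - b\<^sup>2 * xc\<^sup>2 - a\<^sup>2 * yc\<^sup>2"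
definition c2 where "c2 = a\<^sup>2 - b\<^sup>2"

text \<open>Measured from the centre in units of \<open>r\<close>, the ellipse is the zero set of \<open>form r\<close>. For the
  radius of the incircle, \<open>u\<close> and \<open>v\<close> are the sum and the product of the foci of the polar
  dual of the ellipse in the circle.\<close>

definition u where "u r = Complex (2 * r * b\<^sup>2 * xc / e) (2 * r * a\<^sup>2 * yc / e)"
definition v where "v r = r\<^sup>2 * c2 / e"
definition m where "m r = 2 * r\<^sup>2 * (a\<^sup>2 + b\<^sup>2) / e"

definition form where
  "form r p = 4 - 4 * Re (p * cnj (u r)) + 2 * v r * Re (p\<^sup>2) - m r * (cmod p)\<^sup>2"

lemma a_pos: "0 < a" using b_pos b_less_a by simp

lemma c2_pos: "0 < c2"
  using b_pos b_less_a by (simp add: c2_def power_strict_mono)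

lemma e_pos: "0 < e"
proof -
  have "xc\<^sup>2 / a\<^sup>2 + yc\<^sup>2 / b\<^sup>2 < 1" using interior by (simp add: axis_ellipse_interior_def)
  then have "(xc\<^sup>2 / a\<^sup>2 + yc\<^sup>2 / b\<^sup>2) * (a\<^sup>2 * b\<^sup>2) < 1 * (a\<^sup>2 * b\<^sup>2)"
    using a_pos b_pos by (intro mult_strict_right_mono) auto
  moreover have "(xc\<^sup>2 / a\<^sup>2 + yc\<^sup>2 / b\<^sup>2) * (a\<^sup>2 * b\<^sup>2) = b\<^sup>2 * xc\<^sup>2 + a\<^sup>2 * yc\<^sup>2"
    using a_pos b_pos by (simp add: field_simps)
  ultimately show ?thesis by (simp add: e_def)
qed

lemma ellipse_form:
  assumes "r \<noteq> 0"
  shows "1 - ((fst P)\<^sup>2 / a\<^sup>2 + (snd P)\<^sup>2 / b\<^sup>2) = e / (4 * a\<^sup>2 * b\<^sup>2) * form r (rel_coord (xc, yc) r P)"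
proof -
  define X Y where "X = Re (rel_coord (xc, yc) r P)" and "Y = Im (rel_coord (xc, yc) r P)"
  have w: "rel_coord (xc, yc) r P = Complex X Y" by (simp add: X_def Y_def)
  have P: "fst P = xc + r * X" "snd P = yc + r * Y"
    using assms by (simp_all add: X_def Y_def rel_coord_def)
  have "e * form r (Complex X Y) = 4 * e - 8 * r * (b\<^sup>2 * xc * X + a\<^sup>2 * yc * Y)
      + 2 * r\<^sup>2 * c2 * (X\<^sup>2 - Y\<^sup>2) - 2 * r\<^sup>2 * (a\<^sup>2 + b\<^sup>2) * (X\<^sup>2 + Y\<^sup>2)"
    using e_pos unfolding form_def u_def v_def m_def cmod_power2
    by (simp add: field_simps power2_eq_square)
  also have "\<dots> = 4 * (a\<^sup>2 * b\<^sup>2 - b\<^sup>2 * (xc + r * X)\<^sup>2 - a\<^sup>2 * (yc + r * Y)\<^sup>2)"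
    unfolding e_def c2_def by (simp add: power2_eq_square algebra_simps)
  finally have h: "e * form r (Complex X Y)
      = 4 * (a\<^sup>2 * b\<^sup>2 - b\<^sup>2 * (xc + r * X)\<^sup>2 - a\<^sup>2 * (yc + r * Y)\<^sup>2)" .
  have "e / (4 * a\<^sup>2 * b\<^sup>2) * form r (Complex X Y) = e * form r (Complex X Y) / (4 * (a\<^sup>2 * b\<^sup>2))"
    by simp
  also have "\<dots> = (a\<^sup>2 * b\<^sup>2 - b\<^sup>2 * (xc + r * X)\<^sup>2 - a\<^sup>2 * (yc + r * Y)\<^sup>2) / (a\<^sup>2 * b\<^sup>2)"
    unfolding h by (rule mult_divide_mult_cancel_left) simp
  also have "\<dots> = 1 - ((xc + r * X)\<^sup>2 / a\<^sup>2 + (yc + r * Y)\<^sup>2 / b\<^sup>2)"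
    using a_pos b_pos by (simp add: diff_divide_distrib)
  finally show ?thesis unfolding w P by simp
qed

lemma mem_ellipse_iff:
  "r \<noteq> 0 \<Longrightarrow> P \<in> axis_ellipse (0, 0) a b \<longleftrightarrow> form r (rel_coord (xc, yc) r P) = 0"
  using ellipse_form[of r P] e_pos a_pos b_pos
  by (auto simp: axis_ellipse_def case_prod_unfold)

lemma mem_ellipse_interior_iff:
  assumes "r \<noteq> 0"
  shows "P \<in> axis_ellipse_interior (0, 0) a b \<longleftrightarrow> 0 < form r (rel_coord (xc, yc) r P)"
proof -
  have "P \<in> axis_ellipse_interior (0, 0) a b \<longleftrightarrow> 0 < 1 - ((fst P)\<^sup>2 / a\<^sup>2 + (snd P)\<^sup>2 / b\<^sup>2)"
    by (auto simp: axis_ellipse_interior_def case_prod_unfold)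
  also have "\<dots> \<longleftrightarrow> 0 < form r (rel_coord (xc, yc) r P)"
  proof -
    have "0 < e / (4 * a\<^sup>2 * b\<^sup>2)" using e_pos a_pos b_pos by simp
    then show ?thesis unfolding ellipse_form[OF assms] by (metis mult_pos_pos zero_less_mult_pos)
  qed
  finally show ?thesis .
qed

text \<open>Multiplying by \<open>(y + z)^2\<close> turns incidence of a vertex with the ellipse
  into a symmetric relation of degree 2 in each of its two contact points.\<close>

lemma form_pole_iff:
  fixes y z :: complex
  assumes "cmod y = 1" "cmod z = 1" "y + z \<noteq> 0"
  shows "form r (pole y z) = 0 \<longleftrightarrow>
    (y + z)\<^sup>2 - (y + z) * (u r + cnj (u r) * y * z) + v r * (y\<^sup>2 * z\<^sup>2 + 1) - m r * y * z = 0"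
proof -
  have nz: "y \<noteq> 0" "z \<noteq> 0" using assms by auto
  let ?p = "pole y z"
  have c: "cnj ?p = 2 / (y + z)"
    unfolding pole_def using assms nz by (simp add: cnj_eq_inverse_if_unit field_simps)
  define x where "x = 1 / (y + z)"
  have x: "x * (y + z) = 1" using assms by (simp add: x_def)
  have p: "?p = 2 * y * z * x" "cnj ?p = 2 * x" unfolding c by (simp_all add: x_def pole_def)
  have "complex_of_real (form r ?p)
      = 4 - 2 * (?p * cnj (u r) + cnj ?p * u r) + v r * (?p\<^sup>2 + (cnj ?p)\<^sup>2) - m r * (?p * cnj ?p)"
    unfolding form_def complex_norm_square[symmetric]
    by (simp add: complex_eq_iff power2_eq_square algebra_simps)
  also have "\<dots> = 4 - 2 * (2 * y * z * x * cnj (u r) + 2 * x * u r) + v r * ((2 * y * z * x)\<^sup>2 + (2 * x)\<^sup>2)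
       - m r * (2 * y * z * x * (2 * x))"
    unfolding p(2) unfolding p(1) by (rule refl)
  also have "\<dots> * (y + z)\<^sup>2 = 4 * ((y + z)\<^sup>2 - (y + z) * (u r + cnj (u r) * y * z)
      + v r * (y\<^sup>2 * z\<^sup>2 + 1) - m r * y * z)"
    using x by algebra
  finally have *: "complex_of_real (form r ?p) * (y + z)\<^sup>2 = 4 * ((y + z)\<^sup>2 - (y + z) * (u r + cnj (u r) * y * z)
      + v r * (y\<^sup>2 * z\<^sup>2 + 1) - m r * y * z)" .
  have "form r ?p = 0 \<longleftrightarrow> complex_of_real (form r ?p) * (y + z)\<^sup>2 = 0" using assms(3) by simp
  also have "\<dots> \<longleftrightarrow> (y + z)\<^sup>2 - (y + z) * (u r + cnj (u r) * y * z)
      + v r * (y\<^sup>2 * z\<^sup>2 + 1) - m r * y * z = 0"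
    unfolding * by (simp only: mult_eq_0_iff) simp
  finally show ?thesis .
qed

section \<open>The radius for which the triangles close\<close>

definition A where "A = sqrt (a^4 - c2 * xc\<^sup>2)"
definition B where "B = sqrt (b^4 + c2 * yc\<^sup>2)"
definition S where "S = b * A + a * B"
text \<open>The inradius; \<open>S / c2\<close> is the other positive root of the closing condition.
  The product \<open>A * B\<close> is the \<delta> of the theorem.\<close>

definition \<rho> where "\<rho> = (b * A - a * B) / c2"

lemma xc_bound: "b\<^sup>2 * xc\<^sup>2 + a\<^sup>2 * yc\<^sup>2 < a\<^sup>2 * b\<^sup>2"
  using e_pos by (simp add: e_def)

lemma xc_less: "xc\<^sup>2 < a\<^sup>2"
proof -
  have "b\<^sup>2 * xc\<^sup>2 < b\<^sup>2 * a\<^sup>2" using xc_bound by (smt (verit) mult.commute zero_le_mult_iff zero_le_power2)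
  then show ?thesis using b_pos by simp
qed

lemma A_pos: "0 < A" and A_sq: "A\<^sup>2 = a^4 - c2 * xc\<^sup>2"
proof -
  have "c2 * xc\<^sup>2 \<le> c2 * a\<^sup>2" using xc_less c2_pos by simp
  also have "\<dots> < a\<^sup>2 * a\<^sup>2" using a_pos b_pos by (simp add: c2_def algebra_simps)
  finally have "0 < a^4 - c2 * xc\<^sup>2" by (simp add: power4_eq_xxxx power2_eq_square)
  then show "0 < A" "A\<^sup>2 = a^4 - c2 * xc\<^sup>2" by (simp_all add: A_def)
qed

lemma B_pos: "0 < B" and B_sq: "B\<^sup>2 = b^4 + c2 * yc\<^sup>2"
proof -
  have "0 < b^4 + c2 * yc\<^sup>2" using b_pos c2_pos by (simp add: add_pos_nonneg)
  then show "0 < B" "B\<^sup>2 = b^4 + c2 * yc\<^sup>2" by (simp_all add: B_def)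
qed

lemma S_pos: "0 < S"
  using A_pos B_pos a_pos b_pos by (simp add: S_def add_pos_pos)

lemma diff_mult_S: "(b * A - a * B) * S = c2 * e"
proof -
  have "(b * A - a * B) * S = b\<^sup>2 * A\<^sup>2 - a\<^sup>2 * B\<^sup>2"
    by (simp add: S_def power2_eq_square algebra_simps)
  also have "\<dots> = c2 * e"
    unfolding A_sq B_sq by (simp add: c2_def e_def power2_eq_square power4_eq_xxxx algebra_simps)
  finally show ?thesis .
qed

lemma diff_pos: "0 < b * A - a * B"
proof -
  have "0 < (b * A - a * B) * S" unfolding diff_mult_S using c2_pos e_pos by simp
  then show ?thesis using S_pos by (rule zero_less_mult_pos2)
qed

lemma \<rho>_pos: "0 < \<rho>"
  using diff_pos c2_pos by (simp add: \<rho>_def)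

lemma \<rho>_mult_S: "\<rho> * S = e"
  using c2_pos by (simp only: \<rho>_def times_divide_eq_left diff_mult_S) simp

lemma norm_u_sq: "(cmod (u r))\<^sup>2 = 4 * r\<^sup>2 * (b^4 * xc\<^sup>2 + a^4 * yc\<^sup>2) / e\<^sup>2"
  using e_pos unfolding cmod_power2 u_def
  by (simp add: field_simps power2_eq_square power4_eq_xxxx)

text \<open>The left-hand side is Cayley's closing condition; only the smaller root gives a circle
  nested in the ellipse.\<close>

lemma cayley_iff:
  "m r = 1 + (v r)\<^sup>2 - (cmod (u r))\<^sup>2 \<longleftrightarrow>
    ((c2 * r)\<^sup>2 - (b * A - a * B)\<^sup>2) * ((c2 * r)\<^sup>2 - S\<^sup>2) = 0"
proof -
  have "c2\<^sup>2 * e\<^sup>2 * (1 + (v r)\<^sup>2 - (cmod (u r))\<^sup>2 - m r)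
      = c2\<^sup>2 * e\<^sup>2 + c2\<^sup>2 * (r\<^sup>2 * c2)\<^sup>2 - c2\<^sup>2 * (4 * r\<^sup>2 * (b^4 * xc\<^sup>2 + a^4 * yc\<^sup>2))
        - c2\<^sup>2 * e * (2 * r\<^sup>2 * (a\<^sup>2 + b\<^sup>2))"
    using e_pos unfolding norm_u_sq v_def m_def by (simp add: field_simps power2_eq_square)
  also have "\<dots> = (c2 * e)\<^sup>2 + (c2 * r)^4
      - (c2 * r)\<^sup>2 * (4 * (b^4 * xc\<^sup>2 + a^4 * yc\<^sup>2) + 2 * e * (a\<^sup>2 + b\<^sup>2))"
    by (simp add: power2_eq_square power4_eq_xxxx algebra_simps)
  also have "4 * (b^4 * xc\<^sup>2 + a^4 * yc\<^sup>2) + 2 * e * (a\<^sup>2 + b\<^sup>2) = 2 * (b\<^sup>2 * A\<^sup>2 + a\<^sup>2 * B\<^sup>2)"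
    unfolding A_sq B_sq e_def c2_def by (simp add: power2_eq_square power4_eq_xxxx algebra_simps)
  also have "\<dots> = (b * A - a * B)\<^sup>2 + S\<^sup>2"
    by (simp add: S_def power2_eq_square algebra_simps)
  also have "(c2 * e)\<^sup>2 + (c2 * r)^4 - (c2 * r)\<^sup>2 * ((b * A - a * B)\<^sup>2 + S\<^sup>2)
      = ((c2 * r)\<^sup>2 - (b * A - a * B)\<^sup>2) * ((c2 * r)\<^sup>2 - S\<^sup>2)"
    unfolding diff_mult_S[symmetric] by (simp add: power2_eq_square power4_eq_xxxx algebra_simps)
  finally have *: "c2\<^sup>2 * e\<^sup>2 * (1 + (v r)\<^sup>2 - (cmod (u r))\<^sup>2 - m r)
    = ((c2 * r)\<^sup>2 - (b * A - a * B)\<^sup>2) * ((c2 * r)\<^sup>2 - S\<^sup>2)" .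
  have "m r = 1 + (v r)\<^sup>2 - (cmod (u r))\<^sup>2 \<longleftrightarrow> c2\<^sup>2 * e\<^sup>2 * (1 + (v r)\<^sup>2 - (cmod (u r))\<^sup>2 - m r) = 0"
    using c2_pos e_pos by auto
  then show ?thesis unfolding * .
qed

lemma m_\<rho>: "m \<rho> = 1 + (v \<rho>)\<^sup>2 - (cmod (u \<rho>))\<^sup>2"
  unfolding cayley_iff using c2_pos by (simp add: \<rho>_def)

lemma v_pos: "0 < v \<rho>"
  using \<rho>_pos c2_pos e_pos by (simp add: v_def)

lemma v_\<rho>: "v \<rho> = (b * A - a * B) / S"
proof -
  have "v \<rho> = \<rho>\<^sup>2 * c2 / (\<rho> * S)" by (simp add: v_def \<rho>_mult_S)
  also have "\<dots> = \<rho> * c2 / S" using \<rho>_pos by (simp add: power2_eq_square)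
  finally show ?thesis using c2_pos by (simp add: \<rho>_def)
qed

lemma u_\<rho>: "u \<rho> = Complex (2 * b\<^sup>2 * xc / S) (2 * a\<^sup>2 * yc / S)"
  using \<rho>_pos S_pos unfolding u_def \<rho>_mult_S[symmetric] by simp

text \<open>By the closing condition, \<open>m \<rho> - 2 * v \<rho>\<close> equals
  \<open>(1 - v \<rho>)^2 - (cmod (u \<rho>))^2\<close>, and by definition it is a positive multiple
  of \<open>b^2\<close>. The bound yields acute contact triangles, the nesting of the disc and the
  ellipticity of the locus.\<close>

lemma norm_u_less: "cmod (u \<rho>) < 1 - v \<rho>"
proof -
  have "0 < m \<rho> - 2 * v \<rho>"
  proof -
    have "m \<rho> - 2 * v \<rho> = 4 * \<rho>\<^sup>2 * b\<^sup>2 / e"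
      using e_pos by (simp add: m_def v_def c2_def field_simps)
    then show ?thesis using \<rho>_pos b_pos e_pos by simp
  qed
  then have "(cmod (u \<rho>))\<^sup>2 < (1 - v \<rho>)\<^sup>2" unfolding m_\<rho> by (simp add: power2_eq_square algebra_simps)
  moreover have "v \<rho> < 1"
    using A_pos B_pos S_pos a_pos unfolding v_\<rho> by (simp add: S_def)
  ultimately show ?thesis by (metis diff_ge_0_iff_ge less_imp_le power2_less_imp_less)
qed

text \<open>Nesting forces \<open>v r < 1\<close>, that is \<open>(c2 * r)^2 < c2 * e\<close>. As
  \<open>c2 * e\<close> is the product of \<open>b * A - a * B\<close> with the larger number
  \<open>S\<close>, the root belonging to \<open>S\<close> is excluded.\<close>

lemma radius_unique:
  assumes "0 < r" "cball (xc, yc) r \<subseteq> axis_ellipse_interior (0, 0) a b"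
    and "m r = 1 + (v r)\<^sup>2 - (cmod (u r))\<^sup>2"
  shows "r = \<rho>"
proof -
  have r0: "r \<noteq> 0" using assms by simp
  \<comment> \<open>At the top and the bottom of the disc the linear terms of \<open>form\<close>
    are opposite, so adding the two inequalities removes \<open>u r\<close>.\<close>
  have "(xc, yc + r) \<in> cball (xc, yc) r" "(xc, yc - r) \<in> cball (xc, yc) r"
    using assms(1) by (simp_all add: dist_norm norm_Pair)
  then have "0 < form r (rel_coord (xc, yc) r (xc, yc + r))" "0 < form r (rel_coord (xc, yc) r (xc, yc - r))"
    using assms(2) unfolding mem_ellipse_interior_iff[OF r0, symmetric] by auto
  then have "2 * v r + m r < 4"
    using r0 by (simp add: rel_coord_def form_def power2_eq_square cmod_def)
  moreover have "0 < m r - 2 * v r"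
  proof -
    have "m r - 2 * v r = 4 * r\<^sup>2 * b\<^sup>2 / e"
      using e_pos by (simp add: m_def v_def c2_def field_simps)
    then show ?thesis using assms(1) b_pos e_pos by simp
  qed
  ultimately have "v r < 1" by simp
  then have "r\<^sup>2 * c2 < e" using e_pos by (simp add: v_def)
  then have "c2 * (r\<^sup>2 * c2) < c2 * e" using c2_pos by (rule mult_strict_left_mono)
  then have "(c2 * r)\<^sup>2 < (b * A - a * B) * S" unfolding diff_mult_S by (simp add: power2_eq_square mult_ac)
  also have "\<dots> < S * S" using S_pos A_pos B_pos a_pos by (intro mult_strict_right_mono) (auto simp: S_def)
  finally have "(c2 * r)\<^sup>2 - S\<^sup>2 \<noteq> 0" by (simp add: power2_eq_square)
  then have "(c2 * r)\<^sup>2 = (b * A - a * B)\<^sup>2" using assms(3) unfolding cayley_iff by auto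
  then have "c2 * r = b * A - a * B"
    by (rule power2_eq_imp_eq) (use assms(1) c2_pos diff_pos in \<open>simp_all add: less_imp_le\<close>)
  then show ?thesis using c2_pos by (metis \<rho>_def less_irrefl nonzero_mult_div_cancel_left)
qed

text \<open>With \<open>t = cmod p\<close>, the closing condition completes a lower bound for the
  form to the difference of squares \<open>(2 - t * cmod u)^2 - (t * (1 + v))^2\<close>, which is
  positive because \<open>t * (1 + v + cmod u) < 2\<close>.\<close>

lemma form_pos_in_disc:
  assumes "cmod p \<le> 1"
  shows "0 < form \<rho> p"
proof -
  let ?t = "cmod p" and ?u = "cmod (u \<rho>)" and ?v = "v \<rho>"
  have 1: "Re (p * cnj (u \<rho>)) \<le> ?t * ?u"
    using complex_Re_le_cmod[of "p * cnj (u \<rho>)"] by (simp add: norm_mult)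
  have "\<bar>Re (p\<^sup>2)\<bar> \<le> cmod (p\<^sup>2)" by (rule abs_Re_le_cmod)
  then have "- (?t\<^sup>2) \<le> Re (p\<^sup>2)" by (simp add: norm_power)
  then have 2: "?v * - (?t\<^sup>2) \<le> ?v * Re (p\<^sup>2)" using v_pos by (intro mult_left_mono) auto
  have "?t * (1 + ?v + ?u) \<le> 1 * (1 + ?v + ?u)"
    using assms v_pos by (intro mult_right_mono) auto
  also have "\<dots> < 2" using norm_u_less by simp
  finally have "?t * (1 + ?v) < 2 - ?t * ?u" by (simp add: algebra_simps)
  then have "(?t * (1 + ?v))\<^sup>2 < (2 - ?t * ?u)\<^sup>2"
    using v_pos by (intro power_strict_mono) auto
  also have "(2 - ?t * ?u)\<^sup>2 - (?t * (1 + ?v))\<^sup>2 \<le> form \<rho> p"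
    unfolding form_def m_\<rho> using 1 2 by (simp add: power2_eq_square algebra_simps)
  then have "(2 - ?t * ?u)\<^sup>2 \<le> form \<rho> p + (?t * (1 + ?v))\<^sup>2" by simp
  finally show ?thesis by simp
qed

lemma cball_in_ellipse: "cball (xc, yc) \<rho> \<subseteq> axis_ellipse_interior (0, 0) a b"
proof
  fix P assume "P \<in> cball (xc, yc) \<rho>"
  then have d: "dist (xc, yc) P \<le> \<rho>" by simp
  have "(cmod (rel_coord (xc, yc) \<rho> P))\<^sup>2 * \<rho>\<^sup>2 = (dist (xc, yc) P)\<^sup>2"
    using \<rho>_pos unfolding cmod_power2 rel_coord_def dist_norm power2_norm_eq_inner
    by (simp add: inner_prod_def field_simps power2_eq_square)
  also have "\<dots> \<le> 1 * \<rho>\<^sup>2" using d by (simp add: power_mono)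
  finally have "(cmod (rel_coord (xc, yc) \<rho> P))\<^sup>2 \<le> 1" using \<rho>_pos by simp
  then have "cmod (rel_coord (xc, yc) \<rho> P) \<le> 1" by (simp add: abs_square_le_1)
  moreover have "\<rho> \<noteq> 0" using \<rho>_pos by simp
  ultimately show "P \<in> axis_ellipse_interior (0, 0) a b"
    using form_pos_in_disc by (simp only: mem_ellipse_interior_iff)
qed

section \<open>Poncelet triangles and the equation of their Gergonne points\<close>

lemma triangle_relations:
  fixes P1 P2 P3 T1 T2 T3 :: point and z1 z2 z3 :: complex
  assumes P: "P1 \<in> axis_ellipse (0, 0) a b" "P2 \<in> axis_ellipse (0, 0) a b" "P3 \<in> axis_ellipse (0, 0) a b"
    and cb: "cball (xc, yc) r \<subseteq> axis_ellipse_interior (0, 0) a b"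
    and con: "incircle_contacts P1 P2 P3 (xc, yc) r T1 T2 T3"
  defines "z1 \<equiv> rel_coord (xc, yc) r T1" and "z2 \<equiv> rel_coord (xc, yc) r T2" and "z3 \<equiv> rel_coord (xc, yc) r T3"
  shows "r = \<rho>" "z1 + z2 + z3 = u \<rho> + v \<rho> * (z1 * z2 * z3)"
proof -
  have r: "0 < r" "r \<noteq> 0" using con by (auto simp: incircle_contacts_def)
  note co = incircle_contacts_coords[OF con, folded z1_def z2_def z3_def]
  have "form r (pole z2 z3) = 0" "form r (pole z3 z1) = 0" "form r (pole z1 z2) = 0"
    using P co(10-12) mem_ellipse_iff[OF r(2)] by auto
  then have F: "(z1 + z2)\<^sup>2 - (z1 + z2) * (u r + cnj (u r) * z1 * z2) + v r * (z1\<^sup>2 * z2\<^sup>2 + 1) - m r * z1 * z2 = 0"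
    "(z2 + z3)\<^sup>2 - (z2 + z3) * (u r + cnj (u r) * z2 * z3) + v r * (z2\<^sup>2 * z3\<^sup>2 + 1) - m r * z2 * z3 = 0"
    "(z3 + z1)\<^sup>2 - (z3 + z1) * (u r + cnj (u r) * z3 * z1) + v r * (z3\<^sup>2 * z1\<^sup>2 + 1) - m r * z3 * z1 = 0"
    using form_pole_iff[OF co(1,2,9)] form_pole_iff[OF co(2,3,7)] form_pole_iff[OF co(3,1,8)] by auto
  note sums = poncelet_sums[OF co(4-6) F]
  define l where "l = z1 * z2 * z3"
  have l: "l * cnj l = 1"
    using co(1-3) by (intro unit_mult_cnj) (simp add: l_def norm_mult)
  have e2: "z1 * z2 + z2 * z3 + z3 * z1 = l * cnj (u r + v r * l)"
    using unit_sum_cnj[OF co(1-3)] sums(1) by (simp add: l_def)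
  have "m r = 1 - cnj (u r) * (u r + v r * l) + v r * (l * cnj (u r + v r * l))"
    using sums(2) unfolding e2 sums(1) l_def[symmetric] by simp
  \<comment> \<open>The terms linear in \<open>l\<close> cancel and \<open>l * cnj l\<close> is 1,
    so the closing condition no longer depends on the triangle.\<close>
  also have "\<dots> = 1 - u r * cnj (u r) + v r * v r * (l * cnj l)"
    by (simp add: algebra_simps)
  also have "\<dots> = of_real (1 + (v r)\<^sup>2 - (cmod (u r))\<^sup>2)"
    unfolding l using complex_norm_square[of "u r"] by (simp add: power2_eq_square)
  finally have "m r = 1 + (v r)\<^sup>2 - (cmod (u r))\<^sup>2" by (simp only: of_real_eq_iff)
  then show "r = \<rho>" by (rule radius_unique[OF r(1) cb])
  then show "z1 + z2 + z3 = u \<rho> + v \<rho> * (z1 * z2 * z3)" using sums(1) by simp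
qed

lemma gergonne_locus_iff:
  fixes X :: point
  defines "w \<equiv> rel_coord (xc, yc) \<rho> X"
  shows "X \<in> gergonne_locus a b (xc, yc) \<longleftrightarrow>
    cmod (u \<rho> * w - 2 * of_real (v \<rho>)) = cmod (3 * w + v \<rho> * cnj w - 2 * u \<rho>)"
proof -
  have \<rho>0: "\<rho> \<noteq> 0" using \<rho>_pos by simp
  let ?U = "u \<rho>" and ?V = "complex_of_real (v \<rho>)"
  \<comment> \<open>Inserting \<open>e1 = u + v * l\<close> and \<open>e2 = l * cnj u + v\<close>
    makes the equation of the symmedian point affine in \<open>l\<close>.\<close>
  have gerg: "3 * w + e2 * cnj w = 2 * e1 \<longleftrightarrow> l * (cnj ?U * cnj w - 2 * ?V) = 2 * ?U - 3 * w - ?V * cnj w"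
    if "cmod l = 1" "e1 = ?U + ?V * l" "e2 = l * cnj e1" for l e1 e2
  proof -
    have "l * cnj l = 1" using that(1) by (rule unit_mult_cnj)
    then have "e2 = l * cnj ?U + ?V" using that by (simp add: algebra_simps)
    then have "3 * w + e2 * cnj w - 2 * e1
      = l * (cnj ?U * cnj w - 2 * ?V) - (2 * ?U - 3 * w - ?V * cnj w)"
      by (simp add: that(2) algebra_simps)
    then show ?thesis by (metis eq_iff_diff_eq_0)
  qed
  have "X \<in> gergonne_locus a b (xc, yc) \<longleftrightarrow>
    (\<exists>l. cmod l = 1 \<and> l * (cnj ?U * cnj w - 2 * ?V) = 2 * ?U - 3 * w - ?V * cnj w)"
  proof
    assume "X \<in> gergonne_locus a b (xc, yc)"
    then obtain P1 P2 P3 r T1 T2 T3 C' r' T1' T2' T3' where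
      P: "P1 \<in> axis_ellipse (0, 0) a b" "P2 \<in> axis_ellipse (0, 0) a b" "P3 \<in> axis_ellipse (0, 0) a b"
      and cb: "cball (xc, yc) r \<subseteq> axis_ellipse_interior (0, 0) a b"
      and con: "incircle_contacts P1 P2 P3 (xc, yc) r T1 T2 T3"
      and con': "incircle_contacts P1 P2 P3 C' r' T1' T2' T3'"
      and X: "X \<in> affine hull {P1, T1'}" "X \<in> affine hull {P2, T2'}" "X \<in> affine hull {P3, T3'}"
      unfolding gergonne_locus_def poncelet_triangles_def is_gergonne_point_def by auto
    note X = X[unfolded incircle_contacts_unique[OF con con']]
    have r: "r = \<rho>" using triangle_relations(1)[OF P cb con] .
    note con = con[unfolded r]
    define z1 z2 z3 where z: "z1 = rel_coord (xc, yc) \<rho> T1" "z2 = rel_coord (xc, yc) \<rho> T2"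
      "z3 = rel_coord (xc, yc) \<rho> T3"
    note co = incircle_contacts_coords[OF con, folded z]
    have e1: "z1 + z2 + z3 = ?U + ?V * (z1 * z2 * z3)"
      using triangle_relations(2)[OF P cb[unfolded r] con] unfolding z .
    have "w \<in> affine hull {pole z2 z3, z1} \<and> w \<in> affine hull {pole z3 z1, z2} \<and> w \<in> affine hull {pole z1 z2, z3}"
      unfolding co(10-12)[symmetric] unfolding w_def z rel_coord_affine_hull[OF \<rho>0] using X by simp
    then have g: "3 * w + (z1 * z2 + z2 * z3 + z3 * z1) * cnj w = 2 * (z1 + z2 + z3)"
      using gergonne_iff[OF co(1-9) pole_def pole_def pole_def co(13-15)] by simp
    show "\<exists>l. cmod l = 1 \<and> l * (cnj ?U * cnj w - 2 * ?V) = 2 * ?U - 3 * w - ?V * cnj w"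
    proof (intro exI conjI)
      show l: "cmod (z1 * z2 * z3) = 1" using co(1-3) by (simp add: norm_mult)
      show "z1 * z2 * z3 * (cnj ?U * cnj w - 2 * ?V) = 2 * ?U - 3 * w - ?V * cnj w"
        using g gerg[OF l e1 unit_sum_cnj[OF co(1-3), symmetric]] by blast
    qed
  next
    assume "\<exists>l. cmod l = 1 \<and> l * (cnj ?U * cnj w - 2 * ?V) = 2 * ?U - 3 * w - ?V * cnj w"
    then obtain l where l: "cmod l = 1"
      and w: "l * (cnj ?U * cnj w - 2 * ?V) = 2 * ?U - 3 * w - ?V * cnj w" by blast
    \<comment> \<open>This is where \<open>norm_u_less\<close> makes every \<open>l\<close> on the
      unit circle the product of an acute contact triple.\<close>
    have h: "cmod (?U + ?V * l) < 1"
      using norm_triangle_ineq[of ?U "?V * l"] l norm_u_less v_pos by (simp add: norm_mult)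
    obtain z1 z2 z3 where un: "cmod z1 = 1" "cmod z2 = 1" "cmod z3 = 1"
      and d: "z1 \<noteq> z2" "z2 \<noteq> z3" "z3 \<noteq> z1" and e1: "z1 + z2 + z3 = ?U + ?V * l" and e3: "z1 * z2 * z3 = l"
      using unit_triple_exists[OF h l] by metis
    have e2: "z1 * z2 + z2 * z3 + z3 * z1 = l * cnj (z1 + z2 + z3)"
      using unit_sum_cnj[OF un] e3 by simp
    obtain T1 T2 T3 where T: "z1 = rel_coord (xc, yc) \<rho> T1" "z2 = rel_coord (xc, yc) \<rho> T2" "z3 = rel_coord (xc, yc) \<rho> T3"
      using rel_coord_surj[OF \<rho>0] by metis
    obtain P1 P2 P3 where P: "rel_coord (xc, yc) \<rho> P1 = pole z2 z3" "rel_coord (xc, yc) \<rho> P2 = pole z3 z1"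
      "rel_coord (xc, yc) \<rho> P3 = pole z1 z2"
      using rel_coord_surj[OF \<rho>0] by metis
    have con: "incircle_contacts P1 P2 P3 (xc, yc) \<rho> T1 T2 T3"
      using incircle_contacts_if_acute[OF \<rho>_pos T un d _ P] h e1 by simp
    note co = incircle_contacts_coords[OF con, folded T]
    have l1: "l * cnj l = 1" using l by (rule unit_mult_cnj)
    have e2': "z1 * z2 + z2 * z3 + z3 * z1 = cnj ?U * l + ?V"
      unfolding e2 e1 using l1 by (simp add: algebra_simps)
    have mm: "of_real (m \<rho>) = 1 - cnj ?U * ?U + ?V\<^sup>2"
      unfolding m_\<rho> by (simp add: complex_norm_square[symmetric] mult.commute[of "cnj ?U"])
    have nz: "z1 \<noteq> 0" "z2 \<noteq> 0" "z3 \<noteq> 0" using un by auto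
    have "form \<rho> (pole z1 z2) = 0"
      unfolding form_pole_iff[OF un(1,2) co(9)]
      by (rule poncelet_vertex[OF nz(3) _ _ mm]) (use e1 e2' e3 in simp_all)
    moreover have "form \<rho> (pole z2 z3) = 0"
      unfolding form_pole_iff[OF un(2,3) co(7)]
      by (rule poncelet_vertex[OF nz(1) _ _ mm]) (use e1 e2' e3 in \<open>simp_all add: ac_simps\<close>)
    moreover have "form \<rho> (pole z3 z1) = 0"
      unfolding form_pole_iff[OF un(3,1) co(8)]
      by (rule poncelet_vertex[OF nz(2) _ _ mm]) (use e1 e2' e3 in \<open>simp_all add: ac_simps\<close>)
    ultimately have "{P1, P2, P3} \<subseteq> axis_ellipse (0, 0) a b"
      using mem_ellipse_iff[OF \<rho>0] P by simp
    then have tri: "(P1, P2, P3) \<in> poncelet_triangles a b (xc, yc)"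
      unfolding poncelet_triangles_def using con cball_in_ellipse by blast
    have "3 * w + (z1 * z2 + z2 * z3 + z3 * z1) * cnj w = 2 * (z1 + z2 + z3)"
      using gerg[OF l e1 e2] w by blast
    then have "w \<in> affine hull {pole z2 z3, z1} \<and> w \<in> affine hull {pole z3 z1, z2} \<and> w \<in> affine hull {pole z1 z2, z3}"
      using gergonne_iff[OF co(1-9) pole_def pole_def pole_def co(13-15)] by simp
    then have "X \<in> affine hull {P1, T1}" "X \<in> affine hull {P2, T2}" "X \<in> affine hull {P3, T3}"
      unfolding P[symmetric] unfolding w_def T rel_coord_affine_hull[OF \<rho>0] by auto
    then have "is_gergonne_point P1 P2 P3 X"
      unfolding is_gergonne_point_def using con by blast
    then show "X \<in> gergonne_locus a b (xc, yc)"
      unfolding gergonne_locus_def using tri by blast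
  qed
  also have "\<dots> \<longleftrightarrow> cmod (cnj ?U * cnj w - 2 * ?V) = cmod (2 * ?U - 3 * w - ?V * cnj w)"
    by (rule ex_unit_mult_iff)
  also have "cnj ?U * cnj w - 2 * ?V = cnj (?U * w - 2 * ?V)" by simp
  also have "2 * ?U - 3 * w - ?V * cnj w = - (3 * w + ?V * cnj w - 2 * ?U)" by simp
  finally show ?thesis unfolding complex_mod_cnj norm_minus_cancel .
qed

end

section \<open>The Gergonne locus\<close>

text \<open>For real \<open>v\<close> the map from \<open>w\<close> to
  \<open>3 * w + v * cnj w\<close> scales real and imaginary part by \<open>3 + v\<close> and
  \<open>3 - v\<close>, so no mixed term arises. In the linear part the contributions of
  \<open>v\<close> from the two moduli cancel, which leaves the coefficients
  \<open>- 12 * Re u\<close> and \<open>- 12 * Im u\<close>.\<close>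

lemma gergonne_conic_identity:
  fixes u w :: complex and v :: real
  defines "p \<equiv> (3 + v)\<^sup>2 - (cmod u)\<^sup>2" and "q \<equiv> (3 - v)\<^sup>2 - (cmod u)\<^sup>2"
  assumes nz: "p \<noteq> 0" "q \<noteq> 0"
  shows "(cmod (3 * w + v * cnj w - 2 * u))\<^sup>2 - (cmod (u * w - 2 * of_real v))\<^sup>2 =
    p * (Re w - 6 * Re u / p)\<^sup>2 + q * (Im w - 6 * Im u / q)\<^sup>2 -
    (36 * (Re u)\<^sup>2 / p + 36 * (Im u)\<^sup>2 / q - 4 * ((cmod u)\<^sup>2 - v\<^sup>2))"
proof -
  have sq: "k * (x - 6 * s / k)\<^sup>2 = k * x\<^sup>2 - 12 * s * x + 36 * s\<^sup>2 / k" if "k \<noteq> 0" for k x s :: real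
    using that by (simp add: field_simps power2_eq_square)
  have "(cmod (3 * w + v * cnj w - 2 * u))\<^sup>2 - (cmod (u * w - 2 * of_real v))\<^sup>2 =
    p * (Re w)\<^sup>2 - 12 * Re u * Re w + q * (Im w)\<^sup>2 - 12 * Im u * Im w + 4 * ((cmod u)\<^sup>2 - v\<^sup>2)"
    unfolding p_def q_def cmod_power2 by (simp add: power2_eq_square algebra_simps)
  then show ?thesis unfolding sq[OF nz(1)] sq[OF nz(2)] by simp
qed

context interior_center
begin

definition p where "p = (3 + v \<rho>)\<^sup>2 - (cmod (u \<rho>))\<^sup>2"
definition q where "q = (3 - v \<rho>)\<^sup>2 - (cmod (u \<rho>))\<^sup>2"
definition R where
  "R = 36 * (Re (u \<rho>))\<^sup>2 / p + 36 * (Im (u \<rho>))\<^sup>2 / q - 4 * ((cmod (u \<rho>))\<^sup>2 - (v \<rho>)\<^sup>2)"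

text \<open>\<open>G\<close> and \<open>H\<close> are \<open>p\<close> and \<open>q\<close> cleared
  of the denominator \<open>S^2\<close>, up to the factor 4.\<close>

definition G where "G = (2 * b * A + a * B)\<^sup>2 - b^4 * xc\<^sup>2 - a^4 * yc\<^sup>2"
definition H where "H = (b * A + 2 * a * B)\<^sup>2 - b^4 * xc\<^sup>2 - a^4 * yc\<^sup>2"

definition x7 where "x7 = xc + \<rho> * (6 * Re (u \<rho>) / p)"
definition y7 where "y7 = yc + \<rho> * (6 * Im (u \<rho>) / q)"

lemma v_less_1: "v \<rho> < 1"
  using norm_u_less norm_ge_zero[of "u \<rho>"] by linarith

lemma q_pos: "0 < q" and q_less_p: "q < p" and p_pos: "0 < p"
proof -
  have "(cmod (u \<rho>))\<^sup>2 < (3 - v \<rho>)\<^sup>2"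
    using norm_u_less by (intro power_strict_mono) auto
  then show "0 < q" by (simp add: q_def)
  show "q < p" using v_pos by (simp add: p_def q_def power2_eq_square algebra_simps)
  with \<open>0 < q\<close> show "0 < p" by simp
qed

lemma gergonne_locus_iff_conic:
  "X \<in> gergonne_locus a b (xc, yc) \<longleftrightarrow> p * (fst X - x7)\<^sup>2 + q * (snd X - y7)\<^sup>2 = \<rho>\<^sup>2 * R"
proof -
  define w where "w = rel_coord (xc, yc) \<rho> X"
  have X: "\<rho> * (Re w - 6 * Re (u \<rho>) / p) = fst X - x7" "\<rho> * (Im w - 6 * Im (u \<rho>) / q) = snd X - y7"
  proof -
    have "\<rho> * Re w = fst X - xc" "\<rho> * Im w = snd X - yc"
      using \<rho>_pos by (simp_all add: w_def rel_coord_def)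
    then show "\<rho> * (Re w - 6 * Re (u \<rho>) / p) = fst X - x7" "\<rho> * (Im w - 6 * Im (u \<rho>) / q) = snd X - y7"
      by (simp_all only: x7_def y7_def right_diff_distrib diff_diff_eq)
  qed
  have "X \<in> gergonne_locus a b (xc, yc) \<longleftrightarrow>
      (cmod (u \<rho> * w - 2 * of_real (v \<rho>)))\<^sup>2 = (cmod (3 * w + v \<rho> * cnj w - 2 * u \<rho>))\<^sup>2"
    unfolding gergonne_locus_iff w_def by simp
  also have "\<dots> \<longleftrightarrow> p * (Re w - 6 * Re (u \<rho>) / p)\<^sup>2 + q * (Im w - 6 * Im (u \<rho>) / q)\<^sup>2 - R = 0"
    using gergonne_conic_identity[of "v \<rho>" "u \<rho>" w, folded p_def q_def, folded R_def] p_pos q_pos by auto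
  also have "\<dots> \<longleftrightarrow>
      \<rho>\<^sup>2 * (p * (Re w - 6 * Re (u \<rho>) / p)\<^sup>2 + q * (Im w - 6 * Im (u \<rho>) / q)\<^sup>2 - R) = 0"
    using \<rho>_pos by simp
  also have "\<rho>\<^sup>2 * (p * (Re w - 6 * Re (u \<rho>) / p)\<^sup>2 + q * (Im w - 6 * Im (u \<rho>) / q)\<^sup>2 - R)
      = p * (fst X - x7)\<^sup>2 + q * (snd X - y7)\<^sup>2 - \<rho>\<^sup>2 * R"
    unfolding X[symmetric] power_mult_distrib by (simp add: algebra_simps)
  finally show ?thesis by simp
qed

text \<open>At the zero \<open>w\<close> of the first modulus, the identity exhibits
  \<open>R\<close> as a sum of nonnegative terms. It vanishes only if the second modulus is zero at
  the same \<open>w\<close>; separating real and imaginary part there gives the criterion.\<close>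

lemma R_nonneg: "0 \<le> R"
  and R_eq_0_iff: "R = 0 \<longleftrightarrow> Im (u \<rho>) = 0 \<and> (Re (u \<rho>))\<^sup>2 = v \<rho> * (3 + v \<rho>)"
proof -
  define s t k where "s = Re (u \<rho>)" and "t = Im (u \<rho>)" and "k = v \<rho>"
  have k: "0 < k" "k < 1" using v_pos v_less_1 by (simp_all add: k_def)
  define w where "w = Complex (2 * s / (3 + k)) (2 * t / (3 - k))"
  have "(3 + k) * Re w = 2 * s" "(3 - k) * Im w = 2 * t" using k by (simp_all add: w_def)
  then have "3 * w + v \<rho> * cnj w - 2 * u \<rho> = 0"
    by (simp add: complex_eq_iff s_def t_def k_def algebra_simps)
  then have R: "R = p * (Re w - 6 * s / p)\<^sup>2 + q * (Im w - 6 * t / q)\<^sup>2 + (cmod (u \<rho> * w - 2 * of_real k))\<^sup>2"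
    using gergonne_conic_identity[of "v \<rho>" "u \<rho>" w, folded p_def q_def, folded R_def] p_pos q_pos
    by (simp add: s_def t_def k_def)
  show "0 \<le> R" unfolding R using p_pos q_pos by simp
  show "R = 0 \<longleftrightarrow> Im (u \<rho>) = 0 \<and> (Re (u \<rho>))\<^sup>2 = v \<rho> * (3 + v \<rho>)"
    unfolding s_def[symmetric] t_def[symmetric] k_def[symmetric]
  proof
    assume "R = 0"
    moreover have "0 \<le> p * (Re w - 6 * s / p)\<^sup>2" "0 \<le> q * (Im w - 6 * t / q)\<^sup>2"
      using p_pos q_pos by simp_all
    ultimately have "(cmod (u \<rho> * w - 2 * of_real k))\<^sup>2 \<le> 0" unfolding R by linarith
    then have "u \<rho> * w - 2 * of_real k = 0" by simp
    then have "Re (u \<rho> * w - 2 * of_real k) = 0" "Im (u \<rho> * w - 2 * of_real k) = 0" by simp_all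
    then have re: "s * (2 * s / (3 + k)) - t * (2 * t / (3 - k)) = 2 * k"
      and im: "s * (2 * t / (3 - k)) + t * (2 * s / (3 + k)) = 0"
      by (simp_all add: w_def s_def t_def)
    have "k * k < 9" using k mult_strict_mono[of k 1 k 1] by simp
    then have "s = 0 \<or> t = 0" using im k by (auto simp: field_simps)
    moreover have "s \<noteq> 0"
    proof
      assume "s = 0"
      then have "t * (2 * t / (3 - k)) = - 2 * k" using re by simp
      moreover have "0 \<le> t * (2 * t / (3 - k))" using k by simp
      ultimately show False using k by simp
    qed
    ultimately have "t = 0" by simp
    then show "t = 0 \<and> s\<^sup>2 = k * (3 + k)" using re k by (simp add: field_simps power2_eq_square)
  next
    assume st: "t = 0 \<and> s\<^sup>2 = k * (3 + k)"
    have U: "(cmod (u \<rho>))\<^sup>2 = s\<^sup>2" using st by (simp add: cmod_power2 s_def t_def)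
    have "p = 3 * (3 + k)" unfolding p_def U k_def[symmetric] using st by (simp add: power2_eq_square algebra_simps)
    then show "R = 0"
      unfolding R_def U s_def[symmetric] t_def[symmetric] k_def[symmetric] using st k
      by (simp add: field_simps power2_eq_square)
  qed
qed

text \<open>On the major axis \<open>B\<close> becomes \<open>b^2\<close>, so \<open>A\<close> is
  the only radical left in the criterion for \<open>R = 0\<close>.\<close>

lemma stationary_iff: "stationary_gergonne a b (xc, yc) \<longleftrightarrow> R = 0"
proof -
  have v3: "v \<rho> * (3 + v \<rho>) = (b * A - a * B) * (4 * b * A + 2 * a * B) / S\<^sup>2"
    using S_pos unfolding v_\<rho> by (simp add: S_def field_simps power2_eq_square)
  have "R = 0 \<longleftrightarrow> yc = 0 \<and> (2 * b\<^sup>2 * xc)\<^sup>2 / S\<^sup>2 = (b * A - a * B) * (4 * b * A + 2 * a * B) / S\<^sup>2"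
    unfolding R_eq_0_iff v3 using S_pos a_pos by (simp add: u_\<rho> power_divide)
  also have "\<dots> \<longleftrightarrow> yc = 0 \<and> (2 * b\<^sup>2 * xc)\<^sup>2 = (b * A - a * B) * (4 * b * A + 2 * a * B)"
    using S_pos by simp
  also have "\<dots> \<longleftrightarrow> yc = 0 \<and> 4 * a\<^sup>2 * xc\<^sup>2 = (a\<^sup>2 - b\<^sup>2) * (4 * a\<^sup>2 - b\<^sup>2)"
  proof (rule conj_cong[OF refl])
    assume y: "yc = 0"
    have "B\<^sup>2 = (b\<^sup>2)\<^sup>2" using B_sq y by simp
    then have B: "B = b\<^sup>2" by (rule power2_eq_imp_eq) (use B_pos in simp_all)
    have A2: "A\<^sup>2 = a^4 - (a\<^sup>2 - b\<^sup>2) * xc\<^sup>2" using A_sq by (simp add: c2_def)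
    have pos: "0 < a" "0 < b" by (rule a_pos, rule b_pos)
    show "(2 * b\<^sup>2 * xc)\<^sup>2 = (b * A - a * B) * (4 * b * A + 2 * a * B) \<longleftrightarrow>
      4 * a\<^sup>2 * xc\<^sup>2 = (a\<^sup>2 - b\<^sup>2) * (4 * a\<^sup>2 - b\<^sup>2)"
    proof
      assume "(2 * b\<^sup>2 * xc)\<^sup>2 = (b * A - a * B) * (4 * b * A + 2 * a * B)"
      then have "2 * b\<^sup>2 * (2 * b\<^sup>2 * xc\<^sup>2) = 2 * b\<^sup>2 * ((A - a * b) * (2 * A + a * b))"
        unfolding B by (simp add: power2_eq_square algebra_simps)
      moreover have "2 * b\<^sup>2 \<noteq> 0" using pos by simp
      ultimately have 1: "2 * b\<^sup>2 * xc\<^sup>2 = (A - a * b) * (2 * A + a * b)" by (metis mult_left_cancel)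
      \<comment> \<open>Replacing \<open>A^2\<close> by its value leaves an equation linear in
        \<open>A\<close>, which can be solved for it and squared.\<close>
      have "a * (b * A) = a * (a * (2 * a\<^sup>2 - 2 * xc\<^sup>2 - b\<^sup>2))"
        using 1 A2 by (simp add: power2_eq_square power4_eq_xxxx algebra_simps)
      then have "b * A = a * (2 * a\<^sup>2 - 2 * xc\<^sup>2 - b\<^sup>2)" using pos by simp
      then have "b\<^sup>2 * A\<^sup>2 = a\<^sup>2 * (2 * a\<^sup>2 - 2 * xc\<^sup>2 - b\<^sup>2)\<^sup>2" by (metis power_mult_distrib)
      \<comment> \<open>Squaring introduces the factor \<open>a^2 - xc^2\<close>, which is nonzero
        for an interior point.\<close>
      then have "(a\<^sup>2 - xc\<^sup>2) * ((a\<^sup>2 - b\<^sup>2) * (4 * a\<^sup>2 - b\<^sup>2) - 4 * a\<^sup>2 * xc\<^sup>2) = 0"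
        unfolding A2 by (simp add: power2_eq_square power4_eq_xxxx algebra_simps)
      then show "4 * a\<^sup>2 * xc\<^sup>2 = (a\<^sup>2 - b\<^sup>2) * (4 * a\<^sup>2 - b\<^sup>2)" using xc_less by auto
    next
      assume st: "4 * a\<^sup>2 * xc\<^sup>2 = (a\<^sup>2 - b\<^sup>2) * (4 * a\<^sup>2 - b\<^sup>2)"
      \<comment> \<open>Under \<open>st\<close> the radicand is a perfect square up to the factor
        \<open>4 * a^2\<close>, so \<open>A\<close> is rational in \<open>a\<close> and
        \<open>b\<close>.\<close>
      have "(2 * a * A)\<^sup>2 = 4 * a^6 - (a\<^sup>2 - b\<^sup>2) * (4 * a\<^sup>2 * xc\<^sup>2)"
        unfolding power_mult_distrib A2 by (simp add: power2_eq_square power4_eq_xxxx algebra_simps eval_nat_numeral)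
      also have "\<dots> = (b * (3 * a\<^sup>2 - b\<^sup>2))\<^sup>2"
        unfolding st by (simp add: power2_eq_square power4_eq_xxxx algebra_simps eval_nat_numeral)
      finally have "2 * a * A = b * (3 * a\<^sup>2 - b\<^sup>2)"
      proof (rule power2_eq_imp_eq)
        show "0 \<le> 2 * a * A" using pos A_pos by simp
        have "b\<^sup>2 < a\<^sup>2" using c2_pos by (simp add: c2_def)
        then have "b\<^sup>2 \<le> 3 * a\<^sup>2" using zero_le_power2[of a] by linarith
        then show "0 \<le> b * (3 * a\<^sup>2 - b\<^sup>2)" using pos by simp
      qed
      note aA = this
      have "2 * a * (b * A - a * b\<^sup>2) = b * (2 * a * A) - 2 * a\<^sup>2 * b\<^sup>2"
        "a * (4 * b * A + 2 * a * b\<^sup>2) = 2 * b * (2 * a * A) + 2 * a\<^sup>2 * b\<^sup>2"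
        by (simp_all add: power2_eq_square algebra_simps)
      then have 1: "2 * a * (b * A - a * b\<^sup>2) = b\<^sup>2 * (a\<^sup>2 - b\<^sup>2)"
        "a * (4 * b * A + 2 * a * b\<^sup>2) = 2 * b\<^sup>2 * (4 * a\<^sup>2 - b\<^sup>2)"
        unfolding aA by (simp_all add: power2_eq_square algebra_simps)
      have "2 * a\<^sup>2 * ((b * A - a * b\<^sup>2) * (4 * b * A + 2 * a * b\<^sup>2))
        = (2 * a * (b * A - a * b\<^sup>2)) * (a * (4 * b * A + 2 * a * b\<^sup>2))"
        by (simp add: power2_eq_square)
      also have "\<dots> = 2 * b^4 * ((a\<^sup>2 - b\<^sup>2) * (4 * a\<^sup>2 - b\<^sup>2))"
        unfolding 1 by (simp add: power2_eq_square power4_eq_xxxx)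
      also have "\<dots> = 2 * a\<^sup>2 * (2 * b\<^sup>2 * xc)\<^sup>2"
        unfolding st[symmetric] by (simp add: power2_eq_square power4_eq_xxxx)
      finally show "(2 * b\<^sup>2 * xc)\<^sup>2 = (b * A - a * B) * (4 * b * A + 2 * a * B)"
        unfolding B using pos by simp
    qed
  qed
  finally show ?thesis by (simp add: stationary_gergonne_def)
qed

section \<open>Closed formulas for the centre and the ratio of the axes\<close>

lemma p_mult_S: "p * S\<^sup>2 = 4 * G" and q_mult_S: "q * S\<^sup>2 = 4 * H"
proof -
  have v: "v \<rho> * S = b * A - a * B" using S_pos by (simp add: v_\<rho>)
  have U: "(cmod (u \<rho>))\<^sup>2 * S\<^sup>2 = 4 * b^4 * xc\<^sup>2 + 4 * a^4 * yc\<^sup>2"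
    using S_pos unfolding u_\<rho> cmod_power2 by (simp add: field_simps power2_eq_square power4_eq_xxxx)
  have "p * S\<^sup>2 = (3 * S + v \<rho> * S)\<^sup>2 - (cmod (u \<rho>))\<^sup>2 * S\<^sup>2"
    by (simp add: p_def power2_eq_square algebra_simps)
  also have "\<dots> = 4 * G" unfolding v U by (simp add: S_def G_def power2_eq_square algebra_simps)
  finally show "p * S\<^sup>2 = 4 * G" .
  have "q * S\<^sup>2 = (3 * S - v \<rho> * S)\<^sup>2 - (cmod (u \<rho>))\<^sup>2 * S\<^sup>2"
    by (simp add: q_def power2_eq_square algebra_simps)
  also have "\<dots> = 4 * H" unfolding v U by (simp add: S_def H_def power2_eq_square algebra_simps)
  finally show "q * S\<^sup>2 = 4 * H" .
qed

lemma G_pos: "0 < G" and H_pos: "0 < H"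
proof -
  have "0 < p * S\<^sup>2" "0 < q * S\<^sup>2" using p_pos q_pos S_pos by simp_all
  then show "0 < G" "0 < H" unfolding p_mult_S q_mult_S by simp_all
qed

lemma x7_eq: "x7 = xc * (G + 3 * b\<^sup>2 * e) / G"
proof -
  have "\<rho> * (6 * Re (u \<rho>) / p) = \<rho> * (12 * b\<^sup>2 * xc / S) / p"
    by (simp add: u_\<rho>)
  also have "\<dots> = 12 * b\<^sup>2 * xc * (\<rho> * S) / (p * S\<^sup>2)"
    using S_pos p_pos by (simp add: field_simps power2_eq_square)
  also have "\<dots> = 3 * b\<^sup>2 * xc * e / G" unfolding \<rho>_mult_S p_mult_S by simp
  finally show ?thesis using G_pos by (simp add: x7_def field_simps)
qed

lemma y7_eq: "y7 = yc * (H + 3 * a\<^sup>2 * e) / H"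
proof -
  have "\<rho> * (6 * Im (u \<rho>) / q) = \<rho> * (12 * a\<^sup>2 * yc / S) / q"
    by (simp add: u_\<rho>)
  also have "\<dots> = 12 * a\<^sup>2 * yc * (\<rho> * S) / (q * S\<^sup>2)"
    using S_pos q_pos by (simp add: field_simps power2_eq_square)
  also have "\<dots> = 3 * a\<^sup>2 * yc * e / H" unfolding \<rho>_mult_S q_mult_S by simp
  finally show ?thesis using H_pos by (simp add: y7_def field_simps)
qed

text \<open>The decomposition as \<open>8 * (2 * a^2 - b^2) * A^2 + b^2 * e\<close> shows the sign.
  Exchanging the axes turns the first factor into \<open>2 * b^2 - a^2\<close>, whose sign varies;
  this is why the other coordinate has no such lemma.\<close>

lemma x7_denominator_pos:
  "0 < a\<^sup>2 * (4 * a\<^sup>2 - b\<^sup>2)\<^sup>2 - (4 * a\<^sup>2 - 3 * b\<^sup>2)\<^sup>2 * xc\<^sup>2 - a\<^sup>2 * b\<^sup>2 * yc\<^sup>2"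
proof -
  have "0 < 8 * (2 * a\<^sup>2 - b\<^sup>2) * A\<^sup>2 + b\<^sup>2 * e"
  proof (intro add_pos_pos mult_pos_pos)
    show "0 < 2 * a\<^sup>2 - b\<^sup>2" using c2_pos zero_le_power2[of a] unfolding c2_def by linarith
  qed (use A_pos b_pos e_pos in simp_all)
  also have "\<dots> = a\<^sup>2 * (4 * a\<^sup>2 - b\<^sup>2)\<^sup>2 - (4 * a\<^sup>2 - 3 * b\<^sup>2)\<^sup>2 * xc\<^sup>2 - a\<^sup>2 * b\<^sup>2 * yc\<^sup>2"
    unfolding A_sq c2_def e_def by (simp add: power2_eq_square power4_eq_xxxx algebra_simps)
  finally show ?thesis .
qed

text \<open>Facts 1 and 2 together say that \<open>G\<close> times its conjugate
  \<open>g - 4 * a * b * (A * B)\<close> is \<open>b^2 * e * ?d\<close>. Expanding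
  \<open>(G + 3 * b^2 * e) / G\<close> by the conjugate cancels \<open>b^2 * e\<close> and gives the
  stated fraction.\<close>

lemma x7_formula:
  "x7 = 4 * a * xc * (4 * a^5 + a^3 * b\<^sup>2 + a * b^4 - a * (4 * a\<^sup>2 - 3 * b\<^sup>2) * xc\<^sup>2
            - a * b\<^sup>2 * yc\<^sup>2 - 3 * b * (A * B))
         / (a\<^sup>2 * (4 * a\<^sup>2 - b\<^sup>2)\<^sup>2 - (4 * a\<^sup>2 - 3 * b\<^sup>2)\<^sup>2 * xc\<^sup>2 - a\<^sup>2 * b\<^sup>2 * yc\<^sup>2)"
    (is "_ = 4 * a * xc * (?n - 3 * b * (A * B)) / ?d")
proof -
  define g where "g = 4 * b\<^sup>2 * A\<^sup>2 + a\<^sup>2 * B\<^sup>2 - b^4 * xc\<^sup>2 - a^4 * yc\<^sup>2"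
  have G: "G = g + 4 * a * b * (A * B)"
    by (simp add: G_def g_def power2_eq_square algebra_simps)
  have 1: "?d = 4 * a * ?n - 3 * g"
    unfolding g_def A_sq B_sq c2_def by (simp add: eval_nat_numeral algebra_simps)
  have 2: "(g + 3 * b\<^sup>2 * e) * ?d - 4 * a * ?n * g + 48 * a\<^sup>2 * b\<^sup>2 * (A\<^sup>2 * B\<^sup>2) = 0"
    unfolding g_def A_sq B_sq c2_def e_def by (simp add: eval_nat_numeral algebra_simps)
  have "(G + 3 * b\<^sup>2 * e) * ?d - 4 * a * (?n - 3 * b * (A * B)) * G
    = ((g + 3 * b\<^sup>2 * e) * ?d - 4 * a * ?n * g + 48 * a\<^sup>2 * b\<^sup>2 * (A\<^sup>2 * B\<^sup>2))
      + 4 * a * b * (A * B) * (?d - 4 * a * ?n + 3 * g)"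
    unfolding G by (simp only: power2_eq_square distrib_left distrib_right left_diff_distrib right_diff_distrib) (simp add: ac_simps)
  also have "\<dots> = 0" unfolding 2 unfolding 1 by simp
  finally have 3: "(G + 3 * b\<^sup>2 * e) * ?d = 4 * a * (?n - 3 * b * (A * B)) * G"
    by (simp only: right_minus_eq)
  have "xc * (G + 3 * b\<^sup>2 * e) * ?d = xc * (4 * a * (?n - 3 * b * (A * B)) * G)"
    unfolding mult.assoc[of xc] 3 ..
  also have "\<dots> = 4 * a * xc * (?n - 3 * b * (A * B)) * G" by (simp only: ac_simps)
  finally have 4: "xc * (G + 3 * b\<^sup>2 * e) * ?d = 4 * a * xc * (?n - 3 * b * (A * B)) * G" .
  have nz: "G \<noteq> 0" "?d \<noteq> 0" using G_pos x7_denominator_pos by linarith+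
  show ?thesis unfolding x7_eq frac_eq_eq[OF nz] by (rule 4)
qed

text \<open>As for \<open>x7_formula\<close>, \<open>H\<close> times its conjugate is
  \<open>a^2 * e * ?d\<close>. Since \<open>H > 0\<close>, the conjugate vanishes together with
  \<open>?d\<close>, and so does the numerator: the stated fraction then reads 0/0, while
  \<open>y7\<close> itself is still determined by \<open>y7_eq\<close>.\<close>

lemma y7_formula:
  assumes "b\<^sup>2 * (4 * b\<^sup>2 - a\<^sup>2)\<^sup>2 - (3 * a\<^sup>2 - 4 * b\<^sup>2)\<^sup>2 * yc\<^sup>2 - a\<^sup>2 * b\<^sup>2 * xc\<^sup>2 \<noteq> 0" (is "?d \<noteq> 0")
  shows "y7 = 4 * b * yc * (4 * b^5 + a\<^sup>2 * b^3 + a^4 * b - b * (4 * b\<^sup>2 - 3 * a\<^sup>2) * yc\<^sup>2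
            - a\<^sup>2 * b * xc\<^sup>2 - 3 * a * (A * B))
         / (b\<^sup>2 * (4 * b\<^sup>2 - a\<^sup>2)\<^sup>2 - (3 * a\<^sup>2 - 4 * b\<^sup>2)\<^sup>2 * yc\<^sup>2 - a\<^sup>2 * b\<^sup>2 * xc\<^sup>2)"
    (is "_ = 4 * b * yc * (?n - 3 * a * (A * B)) / _")
proof -
  define h where "h = b\<^sup>2 * A\<^sup>2 + 4 * a\<^sup>2 * B\<^sup>2 - b^4 * xc\<^sup>2 - a^4 * yc\<^sup>2"
  have H: "H = h + 4 * a * b * (A * B)"
    by (simp add: H_def h_def power2_eq_square algebra_simps)
  have 1: "?d = 4 * b * ?n - 3 * h"
    unfolding h_def A_sq B_sq c2_def by (simp add: eval_nat_numeral algebra_simps)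
  have 2: "(h + 3 * a\<^sup>2 * e) * ?d - 4 * b * ?n * h + 48 * a\<^sup>2 * b\<^sup>2 * (A\<^sup>2 * B\<^sup>2) = 0"
    unfolding h_def A_sq B_sq c2_def e_def by (simp add: eval_nat_numeral algebra_simps)
  have "(H + 3 * a\<^sup>2 * e) * ?d - 4 * b * (?n - 3 * a * (A * B)) * H
    = ((h + 3 * a\<^sup>2 * e) * ?d - 4 * b * ?n * h + 48 * a\<^sup>2 * b\<^sup>2 * (A\<^sup>2 * B\<^sup>2))
      + 4 * a * b * (A * B) * (?d - 4 * b * ?n + 3 * h)"
    unfolding H by (simp only: power2_eq_square distrib_left distrib_right left_diff_distrib right_diff_distrib) (simp add: ac_simps)
  also have "\<dots> = 0" unfolding 2 unfolding 1 by simp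
  finally have 3: "(H + 3 * a\<^sup>2 * e) * ?d = 4 * b * (?n - 3 * a * (A * B)) * H"
    by (simp only: right_minus_eq)
  have "yc * (H + 3 * a\<^sup>2 * e) * ?d = yc * (4 * b * (?n - 3 * a * (A * B)) * H)"
    unfolding mult.assoc[of yc] 3 ..
  also have "\<dots> = 4 * b * yc * (?n - 3 * a * (A * B)) * H" by (simp only: ac_simps)
  finally have 4: "yc * (H + 3 * a\<^sup>2 * e) * ?d = 4 * b * yc * (?n - 3 * a * (A * B)) * H" .
  have nz: "H \<noteq> 0" "?d \<noteq> 0" by (rule less_imp_neq[OF H_pos, symmetric], rule assms)
  show ?thesis unfolding y7_eq frac_eq_eq[OF nz] by (rule 4)
qed

text \<open>\<open>G - H\<close> is \<open>3 * (b^2 * A^2 - a^2 * B^2)\<close>, and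
  \<open>diff_mult_S\<close> evaluates this to \<open>3 * c2 * e\<close>.\<close>

lemma G_H_relation: "H + 3 * a\<^sup>2 * e = G + 3 * b\<^sup>2 * e"
  unfolding G_def H_def using diff_mult_S
  by (simp add: S_def c2_def power2_eq_square algebra_simps)

lemma gergonne_locus_stationary:
  assumes "R = 0"
  shows "gergonne_locus a b (xc, yc) = {(x7, y7)}"
proof -
  have "X \<in> gergonne_locus a b (xc, yc) \<longleftrightarrow> X = (x7, y7)" for X
  proof -
    have "0 \<le> p * (fst X - x7)\<^sup>2" "0 \<le> q * (snd X - y7)\<^sup>2" using p_pos q_pos by simp_all
    then have "X \<in> gergonne_locus a b (xc, yc) \<longleftrightarrow> p * (fst X - x7)\<^sup>2 = 0 \<and> q * (snd X - y7)\<^sup>2 = 0"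
      unfolding gergonne_locus_iff_conic assms by (simp add: add_nonneg_eq_0_iff)
    then show ?thesis using p_pos q_pos by (auto simp: prod_eq_iff)
  qed
  then show ?thesis by blast
qed

lemma gergonne_locus_ellipse:
  assumes "0 < R"
  shows "gergonne_locus a b (xc, yc) = axis_ellipse (x7, y7) (\<rho> * sqrt (R / p)) (\<rho> * sqrt (R / q))"
proof -
  have "X \<in> gergonne_locus a b (xc, yc) \<longleftrightarrow> X \<in> axis_ellipse (x7, y7) (\<rho> * sqrt (R / p)) (\<rho> * sqrt (R / q))" for X
  proof -
    have k: "\<rho>\<^sup>2 * R \<noteq> 0" using \<rho>_pos assms by simp
    have "X \<in> axis_ellipse (x7, y7) (\<rho> * sqrt (R / p)) (\<rho> * sqrt (R / q)) \<longleftrightarrow>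
      (fst X - x7)\<^sup>2 / (\<rho>\<^sup>2 * (R / p)) + (snd X - y7)\<^sup>2 / (\<rho>\<^sup>2 * (R / q)) = 1"
      using p_pos q_pos assms by (simp add: axis_ellipse_def case_prod_unfold power_mult_distrib)
    also have "(fst X - x7)\<^sup>2 / (\<rho>\<^sup>2 * (R / p)) + (snd X - y7)\<^sup>2 / (\<rho>\<^sup>2 * (R / q))
      = (p * (fst X - x7)\<^sup>2 + q * (snd X - y7)\<^sup>2) / (\<rho>\<^sup>2 * R)"
      by (simp add: add_divide_distrib mult.commute)
    also have "\<dots> = 1 \<longleftrightarrow> p * (fst X - x7)\<^sup>2 + q * (snd X - y7)\<^sup>2 = \<rho>\<^sup>2 * R"
      using k by (auto simp: divide_eq_1_iff)
    finally show ?thesis unfolding gergonne_locus_iff_conic by blast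
  qed
  then show ?thesis by blast
qed

text \<open>The ratio is \<open>p / q = G / H\<close>. By \<open>G_H_relation\<close> the numerators
  in \<open>x7_eq\<close> and \<open>y7_eq\<close> share one factor, which cancels in the quotient
  of the coordinates and leaves the same \<open>G / H\<close>.\<close>

lemma axes_ratio:
  assumes "0 < R" "xc \<noteq> 0" "yc \<noteq> 0"
  shows "(\<rho> * sqrt (R / q) / (\<rho> * sqrt (R / p)))\<^sup>2 = (y7 * xc) / (x7 * yc)"
proof -
  have "(\<rho> * sqrt (R / q) / (\<rho> * sqrt (R / p)))\<^sup>2 = p / q"
    using \<rho>_pos assms(1) p_pos q_pos by (simp add: power_divide)
  also have "\<dots> = (p * S\<^sup>2) / (q * S\<^sup>2)" using S_pos by simp
  also have "\<dots> = G / H" unfolding p_mult_S q_mult_S by simp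
  also have "\<dots> = (y7 * xc) / (x7 * yc)"
  proof -
    define k where "k = G + 3 * b\<^sup>2 * e"
    have "0 < k" using G_pos e_pos b_pos by (simp add: k_def add_pos_pos)
    then show ?thesis
      unfolding x7_eq y7_eq G_H_relation k_def[symmetric] using assms(2,3) G_pos H_pos by simp
  qed
  finally show ?thesis .
qed

end

text \<open>The denominator for \<open>y7\<close> can vanish, for instance if
  \<open>a = 2 * b\<close> and \<open>C\<close> is the origin, so that formula is conditional. The
  ratio is asserted off the coordinate axes, where its right-hand side has a nonzero
  denominator.\<close>

theorem proposition5:
  fixes a b c xc yc \<delta> :: real
  assumes "0 < b" and "b < a" and "c\<^sup>2 = a\<^sup>2 - b\<^sup>2"
    and "(xc, yc) \<in> axis_ellipse_interior (0, 0) a b"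
    and "\<delta> = sqrt ((b^4 + c\<^sup>2 * yc\<^sup>2) * (a^4 - c\<^sup>2 * xc\<^sup>2))"
  shows "\<exists>x7 y7.
    x7 = 4 * a * xc * (4 * a^5 + a^3 * b\<^sup>2 + a * b^4 - a * (4 * a\<^sup>2 - 3 * b\<^sup>2) * xc\<^sup>2
            - a * b\<^sup>2 * yc\<^sup>2 - 3 * b * \<delta>)
         / (a\<^sup>2 * (4 * a\<^sup>2 - b\<^sup>2)\<^sup>2 - (4 * a\<^sup>2 - 3 * b\<^sup>2)\<^sup>2 * xc\<^sup>2 - a\<^sup>2 * b\<^sup>2 * yc\<^sup>2) \<and>
    (b\<^sup>2 * (4 * b\<^sup>2 - a\<^sup>2)\<^sup>2 - (3 * a\<^sup>2 - 4 * b\<^sup>2)\<^sup>2 * yc\<^sup>2 - a\<^sup>2 * b\<^sup>2 * xc\<^sup>2 \<noteq> 0 \<longrightarrow>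
     y7 = 4 * b * yc * (4 * b^5 + a\<^sup>2 * b^3 + a^4 * b - b * (4 * b\<^sup>2 - 3 * a\<^sup>2) * yc\<^sup>2
            - a\<^sup>2 * b * xc\<^sup>2 - 3 * a * \<delta>)
         / (b\<^sup>2 * (4 * b\<^sup>2 - a\<^sup>2)\<^sup>2 - (3 * a\<^sup>2 - 4 * b\<^sup>2)\<^sup>2 * yc\<^sup>2 - a\<^sup>2 * b\<^sup>2 * xc\<^sup>2)) \<and>
    (if stationary_gergonne a b (xc, yc) then
       gergonne_locus a b (xc, yc) = {(x7, y7)}
     else
       \<exists>a7 b7. 0 < b7 \<and> b7 < a7 \<and>
         gergonne_locus a b (xc, yc) = axis_ellipse (x7, y7) b7 a7 \<and>
         (xc \<noteq> 0 \<and> yc \<noteq> 0 \<longrightarrow> (a7 / b7)\<^sup>2 = (y7 * xc) / (x7 * yc)))"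
proof -
  interpret interior_center a b xc yc by unfold_locales (use assms in simp_all)
  have \<delta>: "\<delta> = A * B"
    unfolding assms(5) assms(3) A_def B_def c2_def real_sqrt_mult by (rule mult.commute)
  show ?thesis
  proof (rule exI[of _ x7], rule exI[of _ y7], intro conjI impI)
    show "if stationary_gergonne a b (xc, yc) then gergonne_locus a b (xc, yc) = {(x7, y7)}
      else \<exists>a7 b7. 0 < b7 \<and> b7 < a7 \<and> gergonne_locus a b (xc, yc) = axis_ellipse (x7, y7) b7 a7 \<and>
         (xc \<noteq> 0 \<and> yc \<noteq> 0 \<longrightarrow> (a7 / b7)\<^sup>2 = (y7 * xc) / (x7 * yc))"
    proof (cases "R = 0")
      case True
      then show ?thesis using gergonne_locus_stationary stationary_iff by simp
    next
      case False
      then have R: "0 < R" using R_nonneg by simp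
      \<comment> \<open>The smaller coefficient \<open>q\<close> belongs to the vertical direction,
        so \<open>a7\<close> is the vertical semi-axis.\<close>
      have "R / p < R / q" using R q_less_p p_pos q_pos by (simp add: frac_less2)
      then have "\<rho> * sqrt (R / p) < \<rho> * sqrt (R / q)" using \<rho>_pos by simp
      moreover have "0 < \<rho> * sqrt (R / p)" using \<rho>_pos R p_pos by simp
      ultimately have "\<exists>a7 b7. 0 < b7 \<and> b7 < a7 \<and> gergonne_locus a b (xc, yc) = axis_ellipse (x7, y7) b7 a7 \<and>
         (xc \<noteq> 0 \<and> yc \<noteq> 0 \<longrightarrow> (a7 / b7)\<^sup>2 = (y7 * xc) / (x7 * yc))"
        using gergonne_locus_ellipse[OF R] axes_ratio[OF R] by blast
      then show ?thesis using False stationary_iff by simp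
    qed
  qed (unfold \<delta>, rule x7_formula, rule y7_formula)
qed

end
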